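(* Let $K$ be a field and let $(V,C)$ be a linear relation over $K$. Then, as Kronecker modules, $(C^\flat,C|_{C^\flat})$ and $(C^\sharp,C|_{C^\sharp})$ are both pure submodules of $(V,C)$.
   Context: Fix a field $K$. A linear relation $(V,C)$ consists of a $K$-vector space $V$ (possibly infinite-dimensional) and a subspace $C$ of $V\oplus V$. For $u\in V$, $Cu=\{v\in V: (u,v)\in C\}$. For a subspace $U$ of $V$, $C|_U$ denotes $C\cap(U\oplus U)$, so that $(U,C|_U)$ is a linear relation. A Kronecker module consists of vector spaces $X,Y$ and two linear maps $p,q:X\to Y$ (equivalently, a module over the path algebra of the quiver with two vertices and two parallel arrows). A linear relation $(V,C)$ is regarded as the Kronecker module with $X=C$, $Y=V$ and $p,q:C\to V$ the first and second projections. Given a linear relation $(V,C)$, define the subspaces $$C^\sharp=\{v\in V: \text{there exist } v_n\in V \text{ for all } n\in\mathbb{Z} \text{ with } v_{n+1}\in Cv_n \text{ for all } n \text{ and } v=v_0\},$$ $$C_\pm=\{v\in V:\text{there exist } v_n\in V\ (n\in\mathbb{Z}) \text{ with } v_{n+1}\in Cv_n \text{ for all } n,\ v=v_0, \text{ and } v_n=0 \text{ for } \pm n\gg 0\},$$ $$C^\flat=C_++C_-.$$ A short exact sequence is pure-exact if it remains exact after tensoring with any module (on the other side); a submodule $N\subseteq M$ is pure if $0\to N\to M\to M/N\to 0$ is pure-exact. *)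

theory Defs
  imports
    "HOL-Algebra.AbelCoset"
    "HOL-Algebra.Module"
    "HOL-Algebra.Elementary_Groups"
    "HOL-Algebra.Free_Abelian_Groups"
    "HOL-Analysis.Product_Vector"
begin

section \<open>Modules over a not necessarily commutative ring\<close>

text \<open>The library locale for modules demands a commutative ring, so only its record type is
  reused; the multiplicative fields of that record (\<open>mult\<close>, \<open>one\<close>) play no role.\<close>

locale left_module = R?: ring R + M?: abelian_group M
  for R (structure) and M :: "('r, 'm) module" (structure) +
  assumes smult_closed: "\<lbrakk>r \<in> carrier R; x \<in> carrier M\<rbrakk> \<Longrightarrow> r \<odot>\<^bsub>M\<^esub> x \<in> carrier M"
    and smult_l_distr: "\<lbrakk>r \<in> carrier R; s \<in> carrier R; x \<in> carrier M\<rbrakk> \<Longrightarrow>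
      (r \<oplus> s) \<odot>\<^bsub>M\<^esub> x = r \<odot>\<^bsub>M\<^esub> x \<oplus>\<^bsub>M\<^esub> s \<odot>\<^bsub>M\<^esub> x"
    and smult_r_distr: "\<lbrakk>r \<in> carrier R; x \<in> carrier M; y \<in> carrier M\<rbrakk> \<Longrightarrow>
      r \<odot>\<^bsub>M\<^esub> (x \<oplus>\<^bsub>M\<^esub> y) = r \<odot>\<^bsub>M\<^esub> x \<oplus>\<^bsub>M\<^esub> r \<odot>\<^bsub>M\<^esub> y"
    and smult_assoc: "\<lbrakk>r \<in> carrier R; s \<in> carrier R; x \<in> carrier M\<rbrakk> \<Longrightarrow>
      (r \<otimes> s) \<odot>\<^bsub>M\<^esub> x = r \<odot>\<^bsub>M\<^esub> (s \<odot>\<^bsub>M\<^esub> x)"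
    and smult_one: "x \<in> carrier M \<Longrightarrow> \<one> \<odot>\<^bsub>M\<^esub> x = x"

text \<open>For a right module, \<open>r \<odot>\<^bsub>N\<^esub> x\<close> stands for the product of \<open>x\<close> by \<open>r\<close> from the right;
  this shows in the axiom \<open>smult_assoc\<close>, which reads \<open>x(rs) = (xr)s\<close>.\<close>

locale right_module = R?: ring R + N?: abelian_group N
  for R (structure) and N :: "('r, 'n) module" (structure) +
  assumes smult_closed: "\<lbrakk>r \<in> carrier R; x \<in> carrier N\<rbrakk> \<Longrightarrow> r \<odot>\<^bsub>N\<^esub> x \<in> carrier N"
    and smult_l_distr: "\<lbrakk>r \<in> carrier R; s \<in> carrier R; x \<in> carrier N\<rbrakk> \<Longrightarrow>
      (r \<oplus> s) \<odot>\<^bsub>N\<^esub> x = r \<odot>\<^bsub>N\<^esub> x \<oplus>\<^bsub>N\<^esub> s \<odot>\<^bsub>N\<^esub> x"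
    and smult_r_distr: "\<lbrakk>r \<in> carrier R; x \<in> carrier N; y \<in> carrier N\<rbrakk> \<Longrightarrow>
      r \<odot>\<^bsub>N\<^esub> (x \<oplus>\<^bsub>N\<^esub> y) = r \<odot>\<^bsub>N\<^esub> x \<oplus>\<^bsub>N\<^esub> r \<odot>\<^bsub>N\<^esub> y"
    and smult_assoc: "\<lbrakk>r \<in> carrier R; s \<in> carrier R; x \<in> carrier N\<rbrakk> \<Longrightarrow>
      (r \<otimes> s) \<odot>\<^bsub>N\<^esub> x = s \<odot>\<^bsub>N\<^esub> (r \<odot>\<^bsub>N\<^esub> x)"
    and smult_one: "x \<in> carrier N \<Longrightarrow> \<one> \<odot>\<^bsub>N\<^esub> x = x"

definition is_submodule ::
    "('r, 'q) ring_scheme \<Rightarrow> ('r, 'm) module \<Rightarrow> ('r, 'm) module \<Rightarrow> bool" where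
  "is_submodule R L M \<longleftrightarrow>
     left_module R M \<and> submodule (carrier L) R M \<and> L = M\<lparr>carrier := carrier L\<rparr>"

definition quotient_module :: "('r, 'm) module \<Rightarrow> ('r, 'm) module \<Rightarrow> ('r, 'm set) module" where
  "quotient_module M L =
     \<lparr>carrier = a_rcosets\<^bsub>M\<^esub> (carrier L), monoid.mult = undefined, monoid.one = undefined,
      ring.zero = carrier L, ring.add = set_add M,
      smult = (\<lambda>r X. \<Union>x\<in>X. carrier L +>\<^bsub>M\<^esub> (r \<odot>\<^bsub>M\<^esub> x))\<rparr>"

definition short_exact ::
    "('a, 'p) monoid_scheme \<Rightarrow> ('b, 'q) monoid_scheme \<Rightarrow> ('c, 's) monoid_scheme
      \<Rightarrow> ('a \<Rightarrow> 'b) \<Rightarrow> ('b \<Rightarrow> 'c) \<Rightarrow> bool" where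
  "short_exact A B C f g \<longleftrightarrow>
     group A \<and> group B \<and> group C \<and>
     f \<in> mon A B \<and> g \<in> epi B C \<and> f ` carrier A = kernel B C g"

definition linear_over ::
    "('r, 'q) ring_scheme \<Rightarrow> ('r, 'a) module \<Rightarrow> ('r, 'b) module \<Rightarrow> ('a \<Rightarrow> 'b) \<Rightarrow> bool" where
  "linear_over R M M' f \<longleftrightarrow>
     f \<in> hom (add_monoid M) (add_monoid M') \<and>
     (\<forall>r\<in>carrier R. \<forall>x\<in>carrier M. f (r \<odot>\<^bsub>M\<^esub> x) = r \<odot>\<^bsub>M'\<^esub> f x)"

definition short_exact_modules ::
    "('r, 'q) ring_scheme \<Rightarrow> ('r, 'a) module \<Rightarrow> ('r, 'b) module \<Rightarrow> ('r, 'c) module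
      \<Rightarrow> ('a \<Rightarrow> 'b) \<Rightarrow> ('b \<Rightarrow> 'c) \<Rightarrow> bool" where
  "short_exact_modules R L M Q f g \<longleftrightarrow>
     left_module R L \<and> left_module R M \<and> left_module R Q \<and>
     linear_over R L M f \<and> linear_over R M Q g \<and>
     short_exact (add_monoid L) (add_monoid M) (add_monoid Q) f g"


section \<open>Tensor products and purity\<close>

text \<open>The tensor product of a right module \<open>N\<close> and a left module \<open>M\<close> over \<open>R\<close> is the free abelian
  group on \<open>N \<times> M\<close> modulo biadditivity and \<open>(n r, m) = (n, r m)\<close>.\<close>

definition tensor_relators ::
    "('r, 'q) ring_scheme \<Rightarrow> ('r, 'n) module \<Rightarrow> ('r, 'm) module \<Rightarrow> ('n \<times> 'm \<Rightarrow>\<^sub>0 int) set" where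
  "tensor_relators R N M =
     {frag_of (n \<oplus>\<^bsub>N\<^esub> n', m) - frag_of (n, m) - frag_of (n', m) | n n' m.
        n \<in> carrier N \<and> n' \<in> carrier N \<and> m \<in> carrier M} \<union>
     {frag_of (n, m \<oplus>\<^bsub>M\<^esub> m') - frag_of (n, m) - frag_of (n, m') | n m m'.
        n \<in> carrier N \<and> m \<in> carrier M \<and> m' \<in> carrier M} \<union>
     {frag_of (r \<odot>\<^bsub>N\<^esub> n, m) - frag_of (n, r \<odot>\<^bsub>M\<^esub> m) | n r m.
        n \<in> carrier N \<and> r \<in> carrier R \<and> m \<in> carrier M}"

definition tensor_subgroup ::
    "('r, 'q) ring_scheme \<Rightarrow> ('r, 'n) module \<Rightarrow> ('r, 'm) module \<Rightarrow> ('n \<times> 'm \<Rightarrow>\<^sub>0 int) set" where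
  "tensor_subgroup R N M =
     generate (free_Abelian_group (carrier N \<times> carrier M)) (tensor_relators R N M)"

definition tensor_product ::
    "('r, 'q) ring_scheme \<Rightarrow> ('r, 'n) module \<Rightarrow> ('r, 'm) module \<Rightarrow> ('n \<times> 'm \<Rightarrow>\<^sub>0 int) set monoid"
  where
  "tensor_product R N M =
     free_Abelian_group (carrier N \<times> carrier M) Mod tensor_subgroup R N M"

text \<open>The map that a linear \<open>f\<close> induces from \<open>N \<otimes> M\<close> to \<open>N \<otimes> M'\<close>, which sends \<open>n \<otimes> m\<close> to \<open>n \<otimes> f m\<close>.\<close>

definition tensor_map ::
    "('r, 'q) ring_scheme \<Rightarrow> ('r, 'n) module \<Rightarrow> ('r, 'b) module \<Rightarrow> ('a \<Rightarrow> 'b)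
      \<Rightarrow> ('n \<times> 'a \<Rightarrow>\<^sub>0 int) set \<Rightarrow> ('n \<times> 'b \<Rightarrow>\<^sub>0 int) set" where
  "tensor_map R N M' f T =
     the_elem ((\<lambda>c. tensor_subgroup R N M' #>\<^bsub>free_Abelian_group (carrier N \<times> carrier M')\<^esub>
                      frag_extend (\<lambda>(n, m). frag_of (n, f m)) c) ` T)"

text \<open>HOL cannot quantify over types inside a formula, so the type \<open>'n\<close> containing the carriers of
  the test modules is a parameter. A theorem concluding \<open>pure_exact TYPE('n)\<close> for a free type
  variable \<open>'n\<close> covers test modules of every type.\<close>

definition pure_exact ::
    "'n itself \<Rightarrow> ('r, 'q) ring_scheme \<Rightarrow> ('r, 'a) module \<Rightarrow> ('r, 'b) module \<Rightarrow> ('r, 'c) module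
      \<Rightarrow> ('a \<Rightarrow> 'b) \<Rightarrow> ('b \<Rightarrow> 'c) \<Rightarrow> bool" where
  "pure_exact _ R L M Q f g \<longleftrightarrow>
     short_exact_modules R L M Q f g \<and>
     (\<forall>N :: ('r, 'n) module. right_module R N \<longrightarrow>
        short_exact (tensor_product R N L) (tensor_product R N M) (tensor_product R N Q)
          (tensor_map R N M f) (tensor_map R N Q g))"

definition pure_submodule ::
    "'n itself \<Rightarrow> ('r, 'q) ring_scheme \<Rightarrow> ('r, 'm) module \<Rightarrow> ('r, 'm) module \<Rightarrow> bool" where
  "pure_submodule T R L M \<longleftrightarrow>
     is_submodule R L M \<and>
     pure_exact T R L M (quotient_module M L) (\<lambda>x. x) (\<lambda>x. carrier L +>\<^bsub>M\<^esub> x)"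


section \<open>Kronecker modules\<close>

text \<open>The paths of the quiver with vertices \<open>X\<close>, \<open>Y\<close> and arrows \<open>p, q : X \<rightarrow> Y\<close>. Paths compose like
  maps: \<open>path_comp b a\<close> is \<open>a\<close> followed by \<open>b\<close>, so that representations are left modules.\<close>

datatype kronecker_path = Vertex_X | Vertex_Y | Arrow_p | Arrow_q

fun path_source :: "kronecker_path \<Rightarrow> kronecker_path" where
  "path_source Vertex_Y = Vertex_Y"
| "path_source _ = Vertex_X"

fun path_target :: "kronecker_path \<Rightarrow> kronecker_path" where
  "path_target Vertex_X = Vertex_X"
| "path_target _ = Vertex_Y"

definition path_comp :: "kronecker_path \<Rightarrow> kronecker_path \<Rightarrow> kronecker_path option" where
  "path_comp b a =
     (if path_source b \<noteq> path_target a then None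
      else if b = path_target a then Some a else Some b)"

text \<open>The path algebra: an element is the family of its coefficients on the four paths.\<close>

definition kronecker_algebra :: "(kronecker_path \<Rightarrow> 'k::field) ring" where
  "kronecker_algebra =
     \<lparr>carrier = UNIV,
      monoid.mult = (\<lambda>f g c. \<Sum>(b, a) \<in> {(b, a). path_comp b a = Some c}. f b * g a),
      monoid.one = (\<lambda>c. if c = Vertex_X \<or> c = Vertex_Y then 1 else 0),
      ring.zero = (\<lambda>c. 0),
      ring.add = (\<lambda>f g c. f c + g c)\<rparr>"

text \<open>The Kronecker module given by subspaces \<open>X\<close>, \<open>Y\<close> and linear maps \<open>p, q\<close> from \<open>X\<close> to \<open>Y\<close>, as a
  left module over the path algebra with underlying space \<open>X \<oplus> Y\<close>.\<close>

definition kronecker_module ::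
    "('k::field \<Rightarrow> 'x \<Rightarrow> 'x) \<Rightarrow> ('k \<Rightarrow> 'y \<Rightarrow> 'y) \<Rightarrow> 'x set \<Rightarrow> 'y set \<Rightarrow> ('x \<Rightarrow> 'y) \<Rightarrow> ('x \<Rightarrow> 'y)
      \<Rightarrow> (kronecker_path \<Rightarrow> 'k, 'x::ab_group_add \<times> 'y::ab_group_add) module" where
  "kronecker_module scaleX scaleY X Y p q =
     \<lparr>carrier = X \<times> Y, monoid.mult = undefined, monoid.one = undefined, ring.zero = 0, ring.add = (+),
      smult = (\<lambda>f (x, y). (scaleX (f Vertex_X) x,
                 scaleY (f Vertex_Y) y + scaleY (f Arrow_p) (p x) + scaleY (f Arrow_q) (q x)))\<rparr>"


section \<open>Linear relations\<close>

text \<open>Throughout, \<open>V\<close> is a subspace of a vector space whose elements form the type \<open>'v\<close>; this puts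
  \<open>(V, C)\<close> and its restrictions \<open>(U, C|\<^sub>U)\<close> on the same footing.\<close>

definition linear_relation ::
    "('k::field \<Rightarrow> 'v::ab_group_add \<Rightarrow> 'v) \<Rightarrow> 'v set \<Rightarrow> ('v \<times> 'v) set \<Rightarrow> bool" where
  "linear_relation scaleV V C \<longleftrightarrow>
     vector_space scaleV \<and> Modules.module.subspace scaleV V \<and>
     Modules.module.subspace (module_prod.scale scaleV scaleV) C \<and> C \<subseteq> V \<times> V"

definition relation_restrict :: "('v \<times> 'v) set \<Rightarrow> 'v set \<Rightarrow> ('v \<times> 'v) set" where
  "relation_restrict C U = C \<inter> (U \<times> U)"

definition relation_module ::
    "('k::field \<Rightarrow> 'v::ab_group_add \<Rightarrow> 'v) \<Rightarrow> 'v set \<Rightarrow> ('v \<times> 'v) set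
      \<Rightarrow> (kronecker_path \<Rightarrow> 'k, ('v \<times> 'v) \<times> 'v) module" where
  "relation_module scaleV V C =
     kronecker_module (module_prod.scale scaleV scaleV) scaleV C V fst snd"

definition bi_infinite_chain :: "'v set \<Rightarrow> ('v \<times> 'v) set \<Rightarrow> (int \<Rightarrow> 'v) \<Rightarrow> bool" where
  "bi_infinite_chain V C v \<longleftrightarrow> (\<forall>n. v n \<in> V \<and> v (n + 1) \<in> C `` {v n})"

definition rel_sharp :: "'v set \<Rightarrow> ('v \<times> 'v) set \<Rightarrow> 'v set" where
  "rel_sharp V C = {v 0 | v. bi_infinite_chain V C v}"

definition rel_plus :: "'v::ab_group_add set \<Rightarrow> ('v \<times> 'v) set \<Rightarrow> 'v set" where
  "rel_plus V C = {v 0 | v. bi_infinite_chain V C v \<and> eventually (\<lambda>n. v n = 0) at_top}"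

definition rel_minus :: "'v::ab_group_add set \<Rightarrow> ('v \<times> 'v) set \<Rightarrow> 'v set" where
  "rel_minus V C = {v 0 | v. bi_infinite_chain V C v \<and> eventually (\<lambda>n. v n = 0) at_bot}"

definition rel_flat :: "'v::ab_group_add set \<Rightarrow> ('v \<times> 'v) set \<Rightarrow> 'v set" where
  "rel_flat V C = {x + y | x y. x \<in> rel_plus V C \<and> y \<in> rel_minus V C}"

end

theory Submission
  imports Defs
begin

text \<open>Let \<open>U\<close> be \<open>C\<^sup>\<sharp>\<close> or \<open>C\<^sup>\<flat>\<close>. Every element of \<open>U\<close> has a \<open>C\<close>-successor and a \<open>C\<close>-predecessor
  in \<open>U\<close>. Purity follows once every subspace \<open>W\<close> with \<open>U \<subseteq> W \<subseteq> V\<close> and \<open>W / U\<close> finite-dimensional has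
  a linear retraction to \<open>U\<close> that respects \<open>C\<close>. This goes by induction on the dimension of \<open>W / U\<close>.
  If the targets (or, dually, the sources) of \<open>C\<close> restricted to \<open>W\<close> do not exhaust \<open>W\<close>, they lie in a
  hyperplane \<open>H \<supseteq> U\<close> of \<open>W\<close>. A retraction of \<open>H\<close> extends to \<open>W\<close>: if \<open>(w, h) \<in> C\<close> with \<open>w \<notin> H\<close>, send
  \<open>w\<close> to a predecessor in \<open>U\<close> of the image of \<open>h\<close>. Otherwise every element of \<open>W\<close> has successors and
  predecessors in \<open>W\<close>, so \<open>W \<subseteq> C\<^sup>\<sharp>\<close>. This settles the case of \<open>C\<^sup>\<sharp>\<close>. For \<open>C\<^sup>\<flat>\<close>, the relation on
  \<open>W / U\<close> is the graph of an automorphism, and the obstruction to a retraction is a linear map from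
  \<open>W / U\<close> to \<open>C\<^sub>+ + C\<^sub>-\<close>. It splits into two parts, each solved by a finite sum along chains that
  reach \<open>0\<close>.\<close>

section \<open>Retractions for linear relations\<close>

locale ambient_space = vector_space scale
  for scale :: "'a::field \<Rightarrow> 'b::ab_group_add \<Rightarrow> 'b" (infixr \<open>*s\<close> 75)
begin

abbreviation lin :: "('b \<Rightarrow> 'b) \<Rightarrow> bool" where
  "lin \<equiv> Vector_Spaces.linear scale scale"

abbreviation pair_subspace :: "('b \<times> 'b) set \<Rightarrow> bool" where
  "pair_subspace \<equiv> Modules.module.subspace (module_prod.scale scale scale)"

lemma pair_subspace_iff:
  "pair_subspace R \<longleftrightarrow> (0, 0) \<in> R \<and>
     (\<forall>x y x' y'. (x, y) \<in> R \<longrightarrow> (x', y') \<in> R \<longrightarrow> (x + x', y + y') \<in> R) \<and>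
     (\<forall>c x y. (x, y) \<in> R \<longrightarrow> (c *s x, c *s y) \<in> R)"
proof -
  interpret P: vector_space_prod scale scale
    by unfold_locales
  show ?thesis
    unfolding P.p.subspace_def zero_prod_def P.scale_def by fastforce
qed

lemma pair_subspace_0: "pair_subspace R \<Longrightarrow> (0, 0) \<in> R"
  and pair_subspace_add:
    "pair_subspace R \<Longrightarrow> (x, y) \<in> R \<Longrightarrow> (x', y') \<in> R \<Longrightarrow> (x + x', y + y') \<in> R"
  and pair_subspace_scale: "pair_subspace R \<Longrightarrow> (x, y) \<in> R \<Longrightarrow> (c *s x, c *s y) \<in> R"
  by (auto simp: pair_subspace_iff)

lemma pair_subspace_diff:
  assumes "pair_subspace R" "(x, y) \<in> R" "(x', y') \<in> R"
  shows "(x - x', y - y') \<in> R"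
  using pair_subspace_add[OF assms(1,2) pair_subspace_scale[OF assms(1,3), of "-1"]] by simp

lemma pair_subspace_converse: "pair_subspace (R\<inverse>) \<longleftrightarrow> pair_subspace R"
  unfolding pair_subspace_iff by auto

lemma linI:
  "(\<And>x y. f (x + y) = f x + f y) \<Longrightarrow> (\<And>c x. f (c *s x) = c *s f x) \<Longrightarrow> lin f"
  by (simp add: Vector_Spaces.linear_iff vector_space_axioms)

lemma lin_add: "lin f \<Longrightarrow> f (x + y) = f x + f y"
  and lin_scale: "lin f \<Longrightarrow> f (c *s x) = c *s f x"
  by (simp_all add: Vector_Spaces.linear_iff)

lemma lin_0: "lin f \<Longrightarrow> f 0 = 0"
  by (metis lin_add add_cancel_right_left)

lemma lin_diff: "lin f \<Longrightarrow> f (x - y) = f x - f y"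
  by (metis lin_add add_diff_cancel diff_add_cancel)

section \<open>Linear selections from relations, and hyperplanes\<close>

text \<open>Source of the linear maps chosen below. A basis of \<open>U\<close> is extended to one
  of \<open>W\<close>; \<open>g\<close> follows \<open>h\<close> on the old basis vectors and takes
  an arbitrary \<open>R\<close>-successor on the new ones. The \<open>x\<close> with
  \<open>(x, g x) \<in> R\<close> form a subspace since \<open>R\<close> is one, so checking the
  basis suffices.\<close>

lemma exists_linear_selection:
  assumes R: "pair_subspace R" and U: "subspace U" and W: "subspace W" and "U \<subseteq> W"
    and h: "lin h" "\<And>x. x \<in> U \<Longrightarrow> (x, h x) \<in> R"
    and total: "\<And>x. x \<in> W \<Longrightarrow> \<exists>y. (x, y) \<in> R"
  shows "\<exists>g. lin g \<and> (\<forall>x\<in>U. g x = h x) \<and> (\<forall>x\<in>W. (x, g x) \<in> R)"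
proof -
  interpret P: vector_space_pair scale scale
    by unfold_locales
  obtain B0 where B0: "B0 \<subseteq> U" "independent B0" "U \<subseteq> span B0"
    using maximal_independent_subset[of U] by blast
  obtain B where B: "B0 \<subseteq> B" "B \<subseteq> W" "independent B" "W \<subseteq> span B"
    using maximal_independent_subset_extend[of B0 W] B0 \<open>U \<subseteq> W\<close> by blast
  obtain g where g: "lin g" "\<forall>x\<in>B. g x = (if x \<in> B0 then h x else SOME y. (x, y) \<in> R)"
    using P.linear_independent_extend[OF B(3), of "\<lambda>x. if x \<in> B0 then h x else SOME y. (x, y) \<in> R"]
    by blast
  have gh: "g x = h x" if "x \<in> U" for x
    by (rule P.linear_eq_on[OF g(1) h(1)]) (use g(2) B B0 that in auto)
  have "span B \<subseteq> {x. (x, g x) \<in> R}"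
  proof (rule span_minimal)
    have "(x, SOME y. (x, y) \<in> R) \<in> R" if "x \<in> B" for x
      using someI_ex[OF total] that B by blast
    then show "B \<subseteq> {x. (x, g x) \<in> R}"
      using g(2) h(2) B0 by auto
    show "subspace {x. (x, g x) \<in> R}"
      using R g(1) by (auto simp: subspace_def pair_subspace_iff lin_add lin_scale lin_0)
  qed
  then show ?thesis
    using g(1) gh B(4) by blast
qed

text \<open>The functional is the coordinate at \<open>b\<close> for a basis of the ambient space
  that contains \<open>b\<close> and a basis of \<open>H\<close>.\<close>

lemma separating_functional:
  assumes H: "subspace H" and "b \<notin> H"
  obtains f where "\<And>x y. f (x + y) = f x + f y" "\<And>c x. f (c *s x) = c * f x"
    "\<And>x. x \<in> H \<Longrightarrow> f x = 0" "f b = 1"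
proof -
  obtain B0 where B0: "B0 \<subseteq> H" "independent B0" "H \<subseteq> span B0"
    using maximal_independent_subset[of H] by blast
  then have span_B0: "span B0 = H"
    using H span_subspace by blast
  then have ind: "independent (insert b B0)"
    using B0 \<open>b \<notin> H\<close> independent_insertI by blast
  let ?E = "extend_basis (insert b B0)"
  have E: "independent ?E" "span ?E = UNIV" "insert b B0 \<subseteq> ?E"
    using ind independent_extend_basis span_extend_basis extend_basis_superset by auto
  define f where "f x = representation ?E x b" for x
  show thesis
  proof
    show add: "f (x + y) = f x + f y" for x y
      using E by (simp add: f_def representation_add)
    show scale: "f (c *s x) = c * f x" for c x
      using E by (simp add: f_def representation_scale)
    have "f x = 0" if "x \<in> B0" for x
    proof -
      have "x \<noteq> b"
        using that \<open>b \<notin> H\<close> B0 by blast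
      then show ?thesis
        using E that by (subst f_def, subst representation_basis) auto
    qed
    moreover have "subspace {x. f x = 0}"
      using add scale E by (auto simp: subspace_def f_def representation_zero)
    ultimately have "span B0 \<subseteq> {x. f x = 0}"
      by (intro span_minimal) auto
    then show "f x = 0" if "x \<in> H" for x
      using span_B0 that by auto
    show "f b = 1"
      using E by (subst f_def, subst representation_basis) auto
  qed
qed

text \<open>Prepares the induction on codimension: \<open>H\<close> misses some
  \<open>b \<in> F\<close>, and a functional that kills \<open>H\<close> but not \<open>b\<close>
  cuts out a hyperplane of \<open>span (U \<union> F)\<close> with fewer generators over
  \<open>U\<close>. The number of generators stands in for the dimension of the quotient by
  \<open>U\<close>.\<close>

lemma hyperplane_finite_codim:
  assumes U: "subspace U" and "finite F" and H: "subspace H" "U \<subseteq> H" "H \<subset> span (U \<union> F)"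
  obtains f b G where "\<And>x y. f (x + y) = f x + f y" "\<And>c x. f (c *s x) = c * f x"
    "\<And>x. x \<in> H \<Longrightarrow> f x = 0" "b \<in> span (U \<union> F)" "f b = 1"
    "finite G" "card G < card F" "span (U \<union> G) = {x \<in> span (U \<union> F). f x = 0}"
proof -
  have "\<not> U \<union> F \<subseteq> H"
    using H span_minimal by blast
  then obtain b where b: "b \<in> F" "b \<notin> H"
    using H by blast
  obtain f where f: "\<And>x y. f (x + y) = f x + f y" "\<And>c x. f (c *s x) = c * f x"
    "\<And>x. x \<in> H \<Longrightarrow> f x = 0" "f b = 1"
    using separating_functional[OF H(1) b(2)] by blast
  have f_diff: "f (x - y) = f x - f y" for x y
    using f(1)[of "x - y" y] by simp
  have f_0: "f 0 = 0"
    using f_diff[of 0 0] by simp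
  \<comment> \<open>Projecting \<open>F - {b}\<close> along \<open>b\<close> into the kernel of
    \<open>f\<close> gives the generators of the hyperplane.\<close>
  define G where "G = (\<lambda>x. x - f x *s b) ` (F - {b})"
  have "finite G"
    using \<open>finite F\<close> by (simp add: G_def)
  have "card G \<le> card (F - {b})"
    unfolding G_def using \<open>finite F\<close> by (intro card_image_le) auto
  then have card: "card G < card F"
    using card_Diff1_less[OF \<open>finite F\<close> b(1)] by simp
  have ker: "subspace {x \<in> span (U \<union> F). f x = 0}"
    using f_0 by (auto simp: subspace_def f span_zero span_add span_scale)
  have "x - f x *s b \<in> span (U \<union> F)" if "x \<in> F" for x
    using that b(1) by (intro span_diff span_scale span_base) auto
  then have "U \<union> G \<subseteq> {x \<in> span (U \<union> F). f x = 0}"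
    using H(2) f(3,4) by (auto simp: G_def f_diff f(2) intro: span_base)
  then have le: "span (U \<union> G) \<subseteq> {x \<in> span (U \<union> F). f x = 0}"
    using ker span_minimal by blast
  have "U \<union> F \<subseteq> span (insert b (U \<union> G))"
  proof -
    have "x \<in> span (insert b (U \<union> G))" if "x \<in> F" "x \<noteq> b" for x
      using that by (auto simp: span_breakdown_eq G_def intro!: exI[of _ "f x"] span_base)
    then show ?thesis
      by (auto intro: span_base)
  qed
  then have "span (U \<union> F) \<subseteq> span (insert b (U \<union> G))"
    by (simp add: span_minimal)
  \<comment> \<open>Modulo \<open>span (U \<union> G)\<close> such an \<open>x\<close> is a multiple
    \<open>k *s b\<close>, and applying \<open>f\<close> gives \<open>k = f x = 0\<close>.\<close>
  have "x \<in> span (U \<union> G)" if x: "x \<in> span (U \<union> F)" "f x = 0" for x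
  proof -
    obtain k where k: "x - k *s b \<in> span (U \<union> G)"
      using x \<open>span (U \<union> F) \<subseteq> _\<close> span_breakdown_eq by blast
    then have "f (x - k *s b) = 0"
      using le by blast
    then show ?thesis
      using k x f by (simp add: f_diff)
  qed
  then have "span (U \<union> G) = {x \<in> span (U \<union> F). f x = 0}"
    using le by blast
  then show thesis
    using that[OF f(1,2,3) _ f(4) \<open>finite G\<close> card] b(1) by (simp add: span_base)
qed

section \<open>Retractions that respect a relation\<close>

text \<open>For \<open>U \<subseteq> W\<close> such a map, applied to vectors and to both entries of
  pairs, is a retraction of Kronecker modules from \<open>W\<close> with its restricted relation to
  \<open>U\<close>. Linearity is imposed on the whole ambient space and the rest only on
  \<open>W\<close>, so that maps carry no domain.\<close>

definition relation_retraction ::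
    "('b \<times> 'b) set \<Rightarrow> 'b set \<Rightarrow> 'b set \<Rightarrow> ('b \<Rightarrow> 'b) \<Rightarrow> bool" where
  "relation_retraction C U W \<phi> \<longleftrightarrow>
     lin \<phi> \<and> \<phi> ` W \<subseteq> U \<and> (\<forall>u\<in>U. \<phi> u = u) \<and>
     (\<forall>x\<in>W. \<forall>y\<in>W. (x, y) \<in> C \<longrightarrow> (\<phi> x, \<phi> y) \<in> C)"

lemma relation_retraction_converse:
  "relation_retraction (C\<inverse>) U W \<phi> \<longleftrightarrow> relation_retraction C U W \<phi>"
  by (auto simp: relation_retraction_def)

text \<open>Since \<open>W\<close> is \<open>H\<close> plus one line, an extension is fixed by its
  value at one vector off \<open>H\<close>. By \<open>target\<close> all targets lie in
  \<open>H\<close>, so only pairs with source off \<open>H\<close> impose a condition. After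
  scaling, two such pairs differ by a pair inside \<open>H\<close>, so a single one of them decides
  the value.\<close>

lemma relation_retraction_extend:
  fixes f :: "'b \<Rightarrow> 'a"
  assumes C: "pair_subspace C" and U: "subspace U" and W: "subspace W"
    and f: "\<And>x y. f (x + y) = f x + f y" "\<And>c x. f (c *s x) = c * f x"
    and H: "H = {x \<in> W. f x = 0}" "U \<subseteq> H" and b: "b \<in> W" "f b = 1"
    and pred: "\<And>u. u \<in> U \<Longrightarrow> \<exists>v\<in>U. (v, u) \<in> C"
    and \<phi>: "relation_retraction C U H \<phi>"
    and target: "\<And>x y. x \<in> W \<Longrightarrow> y \<in> W \<Longrightarrow> (x, y) \<in> C \<Longrightarrow> f y = 0"
  obtains \<psi> where "relation_retraction C U W \<psi>"
proof -
  have f_diff: "f (x - y) = f x - f y" for x y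
    using f(1)[of "x - y" y] by simp
  have \<phi>: "lin \<phi>" "\<And>x. x \<in> H \<Longrightarrow> \<phi> x \<in> U" "\<And>u. u \<in> U \<Longrightarrow> \<phi> u = u"
    "\<And>x y. x \<in> H \<Longrightarrow> y \<in> H \<Longrightarrow> (x, y) \<in> C \<Longrightarrow> (\<phi> x, \<phi> y) \<in> C"
    using \<phi> by (auto simp: relation_retraction_def)
  \<comment> \<open>The correction of \<open>\<phi>\<close> is a multiple of \<open>f\<close>,
    chosen so that \<open>w\<close> goes to \<open>u\<close>. As \<open>x - f x *s w\<close> lies in
    \<open>H\<close>, the new map applies \<open>\<phi>\<close> to this part and adds
    \<open>f x *s u\<close>.\<close>
  have extend: "relation_retraction C U W (\<lambda>x. \<phi> x + f x *s (u - \<phi> w))"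
    if w: "w \<in> W" "f w = 1" and u: "u \<in> U"
      and rel: "\<And>x y. x \<in> W \<Longrightarrow> y \<in> H \<Longrightarrow> (x, y) \<in> C \<Longrightarrow>
        (\<phi> (x - f x *s w) + f x *s u, \<phi> y) \<in> C" for w u
  proof -
    let ?\<psi> = "\<lambda>x. \<phi> x + f x *s (u - \<phi> w)"
    have eq: "?\<psi> x = \<phi> (x - f x *s w) + f x *s u" for x
      using \<phi>(1) by (simp add: lin_diff lin_scale algebra_simps)
    have "lin ?\<psi>"
      using \<phi>(1) by (intro linI) (simp_all add: lin_add lin_scale f algebra_simps)
    moreover have "?\<psi> x \<in> U" if "x \<in> W" for x
    proof -
      have "x - f x *s w \<in> H"
        using that w W by (simp add: H f_diff f subspace_diff subspace_scale)
      then show ?thesis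
        unfolding eq using \<phi>(2) u U by (simp add: subspace_add subspace_scale)
    qed
    moreover have "?\<psi> x = x" if "x \<in> U" for x
      using that H \<phi>(3) by auto
    moreover have "(?\<psi> x, ?\<psi> y) \<in> C" if "x \<in> W" "y \<in> W" "(x, y) \<in> C" for x y
    proof -
      have "f y = 0"
        using target that by blast
      then show ?thesis
        using rel[of x y] that unfolding eq[of x] by (simp add: H)
    qed
    ultimately show ?thesis
      by (auto simp: relation_retraction_def)
  qed
  show thesis
  proof (cases "\<exists>x y. x \<in> W \<and> y \<in> W \<and> (x, y) \<in> C \<and> f x \<noteq> 0")
    case True
    then obtain x y where xy: "x \<in> W" "y \<in> W" "(x, y) \<in> C" "f x \<noteq> 0"
      by blast
    \<comment> \<open>\<open>w\<close> is the source off \<open>H\<close>, scaled so that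
      \<open>f w = 1\<close>, and \<open>z\<close> is its target, which lies in \<open>H\<close> by
      \<open>target\<close>.\<close>
    define w z where "w = inverse (f x) *s x" and "z = inverse (f x) *s y"
    have w: "w \<in> W" "f w = 1" "z \<in> W" "(w, z) \<in> C"
      using xy W C by (auto simp: w_def z_def f subspace_scale intro: pair_subspace_scale)
    have "z \<in> H"
      using w target by (auto simp: H)
    obtain u where u: "u \<in> U" "(u, \<phi> z) \<in> C"
      using pred[OF \<phi>(2)[OF \<open>z \<in> H\<close>]] by blast
    \<comment> \<open>Subtracting \<open>f x\<close> times \<open>(w, z)\<close> moves
      \<open>(x, y)\<close> into \<open>H\<close>, where \<open>\<phi>\<close> already respects
      \<open>C\<close>; the same multiple of \<open>(u, \<phi> z)\<close> is then added
      back.\<close>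
    have "(\<phi> (x - f x *s w) + f x *s u, \<phi> y) \<in> C" if "x \<in> W" "y \<in> H" "(x, y) \<in> C" for x y
    proof -
      have "x - f x *s w \<in> H" "y - f x *s z \<in> H"
        using that w \<open>z \<in> H\<close> W by (auto simp: H f_diff f intro!: subspace_diff subspace_scale)
      moreover have "(x - f x *s w, y - f x *s z) \<in> C"
        using that w C by (intro pair_subspace_diff pair_subspace_scale)
      ultimately have "(\<phi> (x - f x *s w), \<phi> (y - f x *s z)) \<in> C"
        using \<phi>(4) by blast
      from pair_subspace_add[OF C this pair_subspace_scale[OF C u(2), of "f x"]]
      show ?thesis
        using \<phi>(1) by (simp add: lin_diff lin_scale)
    qed
    then show thesis
      using extend[of w u] w u that by blast
  next
    case False
    \<comment> \<open>No pair of \<open>W\<close> starts off \<open>H\<close>, so nothing constrains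
      the image of \<open>b\<close>, and \<open>0\<close> will do.\<close>
    have "(\<phi> (x - f x *s b) + f x *s 0, \<phi> y) \<in> C" if "x \<in> W" "y \<in> H" "(x, y) \<in> C" for x y
    proof -
      have "f x = 0"
        using False that by (auto simp: H)
      then show ?thesis
        using that \<phi>(4) by (simp add: H)
    qed
    then show thesis
      using extend[of b 0] b U that by (blast intro: subspace_0)
  qed
qed

text \<open>Induction on \<open>card F\<close>. As long as some element of
  \<open>span (U \<union> F)\<close> lacks a predecessor or a successor there, a hyperplane reduces
  the problem. What remains, a relation total in both directions, is left to the assumption
  \<open>core\<close>, the part in which \<open>rel_sharp\<close> and \<open>rel_flat\<close>
  differ.\<close>

lemma relation_retraction_finite_codim:
  assumes C: "pair_subspace C" and U: "subspace U" and V: "subspace V" and "U \<subseteq> V"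
    and succ: "\<And>u. u \<in> U \<Longrightarrow> \<exists>v\<in>U. (u, v) \<in> C"
    and pred: "\<And>u. u \<in> U \<Longrightarrow> \<exists>v\<in>U. (v, u) \<in> C"
    and core: "\<And>F. \<lbrakk>finite F; F \<subseteq> V; \<And>w. w \<in> span (U \<union> F) \<Longrightarrow> \<exists>v\<in>span (U \<union> F). (w, v) \<in> C;
        \<And>w. w \<in> span (U \<union> F) \<Longrightarrow> \<exists>v\<in>span (U \<union> F). (v, w) \<in> C\<rbrakk> \<Longrightarrow>
      \<exists>\<phi>. relation_retraction C U (span (U \<union> F)) \<phi>"
    and "finite F" "F \<subseteq> V"
  shows "\<exists>\<phi>. relation_retraction C U (span (U \<union> F)) \<phi>"
  using \<open>finite F\<close> \<open>F \<subseteq> V\<close>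
proof (induction "card F" arbitrary: F rule: less_induct)
  case less
  let ?W = "span (U \<union> F)"
  have "?W \<subseteq> V"
    using \<open>U \<subseteq> V\<close> less.prems V by (simp add: span_minimal)
  \<comment> \<open>Stated for arbitrary \<open>D\<close>: with \<open>D = C\<close> it handles
    missing predecessors, with \<open>D = C\<inverse>\<close> missing successors.\<close>
  have step: "\<exists>\<phi>. relation_retraction D U ?W \<phi>"
    if D: "pair_subspace D"
      and succ: "\<And>u. u \<in> U \<Longrightarrow> \<exists>v\<in>U. (u, v) \<in> D"
      and pred: "\<And>u. u \<in> U \<Longrightarrow> \<exists>v\<in>U. (v, u) \<in> D"
      and IH: "\<And>G. \<lbrakk>card G < card F; finite G; G \<subseteq> V\<rbrakk> \<Longrightarrow>
        \<exists>\<phi>. relation_retraction D U (span (U \<union> G)) \<phi>"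
      and w: "w \<in> ?W" "\<not> (\<exists>v\<in>?W. (v, w) \<in> D)" for D w
  proof -
    \<comment> \<open>The targets of \<open>D\<close> inside \<open>?W\<close>; they contain
      \<open>U\<close> by \<open>pred\<close> and miss \<open>w\<close>.\<close>
    let ?H = "{y \<in> ?W. \<exists>x\<in>?W. (x, y) \<in> D}"
    have H: "subspace ?H"
    proof (rule subspaceI)
      show "0 \<in> ?H"
        using pair_subspace_0[OF D] span_zero by blast
      show "x + y \<in> ?H" if "x \<in> ?H" "y \<in> ?H" for x y
        using that by (auto intro: span_add) (meson D pair_subspace_add span_add)
      show "c *s x \<in> ?H" if "x \<in> ?H" for c x
        using that by (auto intro: span_scale) (meson D pair_subspace_scale span_scale)
    qed
    have "U \<subseteq> ?W"
      using span_superset by blast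
    then have U_H: "U \<subseteq> ?H"
      using pred by blast
    have H_W: "?H \<subset> ?W"
      using w by blast
    obtain f b G where f: "\<And>x y. f (x + y) = f x + f y" "\<And>c x. f (c *s x) = c * f x"
      "\<And>x. x \<in> ?H \<Longrightarrow> f x = 0" and b: "b \<in> ?W" "f b = 1"
      and G: "finite G" "card G < card F" "span (U \<union> G) = {x \<in> ?W. f x = 0}"
      by (rule hyperplane_finite_codim[OF U \<open>finite F\<close> H U_H H_W]) (rule that)
    have "G \<subseteq> V"
      using G(3) \<open>?W \<subseteq> V\<close> span_superset[of "U \<union> G"] by blast
    then obtain \<phi> where \<phi>: "relation_retraction D U (span (U \<union> G)) \<phi>"
      using IH G by blast
    have "U \<subseteq> span (U \<union> G)"
      using span_superset by blast
    moreover have "f y = 0" if "x \<in> ?W" "y \<in> ?W" "(x, y) \<in> D" for x y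
      using f(3) that by blast
    ultimately obtain \<psi> where "relation_retraction D U ?W \<psi>"
      using relation_retraction_extend[OF D U subspace_span f(1,2) G(3) _ b pred \<phi>] by blast
    then show ?thesis
      by blast
  qed
  show ?case
  proof (cases "\<exists>w\<in>?W. \<not> (\<exists>v\<in>?W. (v, w) \<in> C)")
    case True
    then show ?thesis
      using step[OF C succ pred less.hyps] by blast
  next
    case no_source: False
    show ?thesis
    proof (cases "\<exists>w\<in>?W. \<not> (\<exists>v\<in>?W. (w, v) \<in> C)")
      case True
      then obtain w where "w \<in> ?W" "\<not> (\<exists>v\<in>?W. (v, w) \<in> C\<inverse>)"
        by auto
      moreover have "\<exists>\<phi>. relation_retraction (C\<inverse>) U (span (U \<union> G)) \<phi>"
        if "card G < card F" "finite G" "G \<subseteq> V" for G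
        using less.hyps[OF that] by (simp add: relation_retraction_converse)
      ultimately have "\<exists>\<phi>. relation_retraction (C\<inverse>) U ?W \<phi>"
        using C succ pred by (intro step) (simp_all add: pair_subspace_converse)
      then show ?thesis
        by (simp add: relation_retraction_converse)
    next
      case False
      then show ?thesis
        using core[OF less.prems] no_source by blast
    qed
  qed
qed

section \<open>Coboundary equations along terminating chains\<close>

lemma lin_compose: "lin f \<Longrightarrow> lin g \<Longrightarrow> lin (\<lambda>x. f (g x))"
  and lin_plus: "lin f \<Longrightarrow> lin g \<Longrightarrow> lin (\<lambda>x. f x + g x)"
  and lin_minus: "lin f \<Longrightarrow> lin g \<Longrightarrow> lin (\<lambda>x. f x - g x)"
  and lin_zero: "lin (\<lambda>x. 0)"
  by (auto intro!: linI simp: lin_add lin_scale algebra_simps)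

text \<open>With \<open>g x \<in> K m\<close> a linearly selected predecessor of \<open>f x\<close>,
  the ansatz \<open>g + a\<close> turns the equation for \<open>f\<close> into the equation for
  \<open>g \<circ> \<sigma>\<close>, one level lower. The solution is thus a finite sum of iterated
  predecessors, which stops because \<open>K 0 = {0}\<close>.\<close>

lemma solve_coboundary_backward:
  assumes C: "pair_subspace C" and U: "subspace U" and W: "subspace W" and "U \<subseteq> W"
    and \<sigma>: "lin \<sigma>" "\<And>x. x \<in> W \<Longrightarrow> \<sigma> x \<in> W" "\<And>x. x \<in> U \<Longrightarrow> \<sigma> x \<in> U"
    and K: "K 0 = {0}" "\<And>n. subspace (K n)" "\<And>n. K n \<subseteq> U"
      "\<And>n u. u \<in> K (Suc n) \<Longrightarrow> \<exists>v\<in>K n. (v, u) \<in> C"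
    and "lin f" "\<And>x. x \<in> W \<Longrightarrow> f x \<in> K m" "\<And>x. x \<in> U \<Longrightarrow> f x = 0"
  shows "\<exists>a. lin a \<and> (\<forall>x\<in>W. a x \<in> U) \<and> (\<forall>x\<in>U. a x = 0) \<and>
    (\<forall>x\<in>W. (a x, a (\<sigma> x) + f x) \<in> C)"
  using assms(12-)
proof (induction m arbitrary: f)
  case 0
  then show ?case
    using lin_zero K(1) C U by (intro exI[of _ "\<lambda>x. 0"]) (auto simp: pair_subspace_0 subspace_0)
next
  case (Suc m)
  let ?R = "{(x, y). y \<in> K m \<and> (y, f x) \<in> C}"
  have "pair_subspace ?R"
    using C K(2)[of m] Suc.prems(1)
    by (auto simp: pair_subspace_iff subspace_def lin_add lin_scale lin_0)
  moreover have "(x, 0) \<in> ?R" if "x \<in> U" for x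
    using that K(2)[of m] C Suc.prems(3) by (simp add: subspace_0 pair_subspace_0)
  moreover have "\<exists>y. (x, y) \<in> ?R" if "x \<in> W" for x
    using K(4) Suc.prems(2)[OF that] by auto
  ultimately have "\<exists>g. lin g \<and> (\<forall>x\<in>U. g x = 0) \<and> (\<forall>x\<in>W. (x, g x) \<in> ?R)"
    by (intro exists_linear_selection U W \<open>U \<subseteq> W\<close> lin_zero)
  then obtain g where "lin g" "\<forall>x\<in>U. g x = 0" "\<forall>x\<in>W. (x, g x) \<in> ?R"
    by (elim exE conjE) (rule that)
  then have g: "lin g" "\<And>x. x \<in> U \<Longrightarrow> g x = 0" "\<And>x. x \<in> W \<Longrightarrow> (x, g x) \<in> ?R"
    by simp_all
  obtain a where a: "lin a" "\<forall>x\<in>W. a x \<in> U" "\<forall>x\<in>U. a x = 0"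
    "\<forall>x\<in>W. (a x, a (\<sigma> x) + g (\<sigma> x)) \<in> C"
    using Suc.IH[of "\<lambda>x. g (\<sigma> x)"] g \<sigma> lin_compose[OF g(1) \<sigma>(1)] by auto
  show ?case
  proof (intro exI[of _ "\<lambda>x. g x + a x"] conjI ballI)
    show "lin (\<lambda>x. g x + a x)"
      using lin_plus g a by blast
    show "g x + a x \<in> U" if "x \<in> W" for x
      using that g(3)[OF that] a K(3)[of m] U by (auto intro: subspace_add)
    show "g x + a x = 0" if "x \<in> U" for x
      using that g a by simp
    show "(g x + a x, g (\<sigma> x) + a (\<sigma> x) + f x) \<in> C" if "x \<in> W" for x
    proof -
      have "(g x, f x) \<in> C" "(a x, a (\<sigma> x) + g (\<sigma> x)) \<in> C"
        using that g a by auto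
      from pair_subspace_add[OF C this] show ?thesis
        by (simp add: ac_simps)
    qed
  qed
qed

text \<open>Mirror image of the backward case: \<open>g x \<in> J m\<close> is a successor of
  \<open>f x\<close>, and the ansatz \<open>a - f \<circ> \<tau>\<close> leads to the equation for
  \<open>g \<circ> \<tau>\<close>. Here \<open>\<tau>\<close> is a left inverse of
  \<open>\<sigma>\<close> modulo \<open>U\<close>, and since \<open>f\<close> vanishes on
  \<open>U\<close>, \<open>f (\<tau> (\<sigma> x)) = f x\<close>.\<close>

lemma solve_coboundary_forward:
  assumes C: "pair_subspace C" and U: "subspace U" and W: "subspace W" and "U \<subseteq> W"
    and \<tau>: "lin \<tau>" "\<And>x. x \<in> W \<Longrightarrow> \<tau> x \<in> W" "\<And>x. x \<in> U \<Longrightarrow> \<tau> x \<in> U"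
    and \<tau>\<sigma>: "\<And>x. x \<in> W \<Longrightarrow> \<tau> (\<sigma> x) - x \<in> U"
    and J: "J 0 = {0}" "\<And>n. subspace (J n)" "\<And>n. J n \<subseteq> U"
      "\<And>n u. u \<in> J (Suc n) \<Longrightarrow> \<exists>v\<in>J n. (u, v) \<in> C"
    and "lin f" "\<And>x. x \<in> W \<Longrightarrow> f x \<in> J m" "\<And>x. x \<in> U \<Longrightarrow> f x = 0"
  shows "\<exists>a. lin a \<and> (\<forall>x\<in>W. a x \<in> U) \<and> (\<forall>x\<in>U. a x = 0) \<and>
    (\<forall>x\<in>W. (a x, a (\<sigma> x) + f x) \<in> C)"
  using assms(13-)
proof (induction m arbitrary: f)
  case 0
  then show ?case
    using lin_zero J(1) C U by (intro exI[of _ "\<lambda>x. 0"]) (auto simp: pair_subspace_0 subspace_0)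
next
  case (Suc m)
  let ?R = "{(x, y). y \<in> J m \<and> (f x, y) \<in> C}"
  have "pair_subspace ?R"
    using C J(2)[of m] Suc.prems(1)
    by (auto simp: pair_subspace_iff subspace_def lin_add lin_scale lin_0)
  moreover have "(x, 0) \<in> ?R" if "x \<in> U" for x
    using that J(2)[of m] C Suc.prems(3) by (simp add: subspace_0 pair_subspace_0)
  moreover have "\<exists>y. (x, y) \<in> ?R" if "x \<in> W" for x
    using J(4) Suc.prems(2)[OF that] by auto
  ultimately have "\<exists>g. lin g \<and> (\<forall>x\<in>U. g x = 0) \<and> (\<forall>x\<in>W. (x, g x) \<in> ?R)"
    by (intro exists_linear_selection U W \<open>U \<subseteq> W\<close> lin_zero)
  then obtain g where "lin g" "\<forall>x\<in>U. g x = 0" "\<forall>x\<in>W. (x, g x) \<in> ?R"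
    by (elim exE conjE) (rule that)
  then have g: "lin g" "\<And>x. x \<in> U \<Longrightarrow> g x = 0" "\<And>x. x \<in> W \<Longrightarrow> (x, g x) \<in> ?R"
    by simp_all
  obtain a where a: "lin a" "\<forall>x\<in>W. a x \<in> U" "\<forall>x\<in>U. a x = 0"
    "\<forall>x\<in>W. (a x, a (\<sigma> x) + g (\<tau> x)) \<in> C"
    using Suc.IH[of "\<lambda>x. g (\<tau> x)"] g \<tau> lin_compose[OF g(1) \<tau>(1)] by auto
  show ?case
  proof (intro exI[of _ "\<lambda>x. a x - f (\<tau> x)"] conjI ballI)
    show "lin (\<lambda>x. a x - f (\<tau> x))"
      by (rule lin_minus[OF a(1) lin_compose[OF Suc.prems(1) \<tau>(1)]])
    show "a x - f (\<tau> x) \<in> U" if "x \<in> W" for x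
      using that Suc.prems(2)[OF \<tau>(2)[OF that]] a J(3)[of "Suc m"] U
      by (auto intro: subspace_diff)
    show "a x - f (\<tau> x) = 0" if "x \<in> U" for x
      using that a \<tau> Suc.prems by simp
    show "(a x - f (\<tau> x), a (\<sigma> x) - f (\<tau> (\<sigma> x)) + f x) \<in> C" if "x \<in> W" for x
    proof -
      have "(f (\<tau> x), g (\<tau> x)) \<in> C" "(a x, a (\<sigma> x) + g (\<tau> x)) \<in> C"
        using that g a \<tau> by auto
      from pair_subspace_diff[OF C this(2,1)] have "(a x - f (\<tau> x), a (\<sigma> x)) \<in> C"
        by simp
      moreover have "f (\<tau> (\<sigma> x)) = f x"
        using Suc.prems(3)[OF \<tau>\<sigma>[OF that]] Suc.prems(1) by (simp add: lin_diff)
      ultimately show ?thesis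
        by simp
    qed
  qed
qed

lemma subspace_Union_chain:
  fixes J :: "nat \<Rightarrow> 'b set"
  assumes J: "\<And>n. subspace (J n)" "mono J"
  shows "subspace (\<Union>n. J n)"
proof (rule subspaceI)
  show "0 \<in> (\<Union>n. J n)"
    using J(1) by (auto intro: subspace_0)
  show "c *s x \<in> (\<Union>n. J n)" if "x \<in> (\<Union>n. J n)" for c x
    using that J(1) by (auto intro: subspace_scale)
  fix x y assume "x \<in> (\<Union>n. J n)" "y \<in> (\<Union>n. J n)"
  then obtain m n where "x \<in> J m" "y \<in> J n"
    by blast
  then have "x \<in> J (max m n)" "y \<in> J (max m n)"
    using monoD[OF J(2), of m "max m n"] monoD[OF J(2), of n "max m n"] by auto
  then show "x + y \<in> (\<Union>n. J n)"
    using J(1) by (blast intro: subspace_add)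
qed

text \<open>Here finite dimension enters: modulo \<open>U\<close> the map \<open>f\<close> is
  determined by its values on \<open>F\<close>, and finitely many values lie in one level of the
  chain. This bounds the length of the coboundary sums.\<close>

lemma image_in_union_level:
  fixes J :: "nat \<Rightarrow> 'b set"
  assumes J: "\<And>n. subspace (J n)" "mono J" and "lin f" "finite F"
    and U: "subspace U" "\<And>x. x \<in> U \<Longrightarrow> f x = 0"
    and "\<And>x. x \<in> span (U \<union> F) \<Longrightarrow> f x \<in> (\<Union>n. J n)"
  shows "\<exists>m. \<forall>x\<in>span (U \<union> F). f x \<in> J m"
proof -
  have "\<exists>m. f ` F \<subseteq> J m"
  proof -
    have "\<forall>x\<in>F. \<exists>n. f x \<in> J n"
      using assms(7) by (auto intro: span_base)
    then obtain n where n: "\<And>x. x \<in> F \<Longrightarrow> f x \<in> J (n x)"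
      by metis
    \<comment> \<open>For empty \<open>F\<close> the maximum is an unspecified number and the claim
      is vacuous.\<close>
    have "f x \<in> J (Max (n ` F))" if "x \<in> F" for x
      using n[OF that] monoD[OF J(2), of "n x" "Max (n ` F)"] that \<open>finite F\<close> by auto
    then show ?thesis
      by blast
  qed
  then obtain m where m: "f ` F \<subseteq> J m"
    by blast
  have "span (U \<union> F) \<subseteq> {x. f x \<in> J m}"
  proof (rule span_minimal)
    show "U \<union> F \<subseteq> {x. f x \<in> J m}"
      using m U(2) J(1)[of m] by (auto simp: subspace_0)
    show "subspace {x. f x \<in> J m}"
      using J(1)[of m] \<open>lin f\<close> by (auto simp: subspace_def lin_add lin_scale lin_0)
  qed
  then show ?thesis
    by blast
qed

text \<open>Turns the splitting of \<open>f x\<close> into an element of \<open>P\<close> and one of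
  \<open>Q\<close> into a linear relation between \<open>x\<close> and the part in \<open>P\<close>,
  so that \<open>exists_linear_selection\<close> can choose the part linearly even where
  \<open>P\<close> and \<open>Q\<close> overlap.\<close>

lemma pair_subspace_split:
  assumes P: "subspace P" and Q: "subspace Q" and f: "lin f"
  shows "pair_subspace {(x, y). y \<in> P \<and> f x - y \<in> Q}"
proof -
  have "f (x + x') - (y + y') \<in> Q" if "f x - y \<in> Q" "f x' - y' \<in> Q" for x x' y y'
    using subspace_add[OF Q that] f by (simp add: lin_add algebra_simps)
  moreover have "f (c *s x) - c *s y \<in> Q" if "f x - y \<in> Q" for c x y
    using subspace_scale[OF Q that, of c] f by (simp add: lin_scale algebra_simps)
  ultimately show ?thesis
    using P subspace_0[OF Q] lin_0[OF f] unfolding pair_subspace_iff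
    by (simp add: subspace_0 subspace_add subspace_scale)
qed

text \<open>On \<open>W / U\<close> the relation is the graph of an automorphism with selections \<open>\<sigma>\<close> and \<open>\<tau>\<close> of it and
  of its inverse, so that a linear projection to \<open>U\<close> fails to respect \<open>C\<close> only by the map
  \<open>\<beta> = \<pi> \<sigma> - \<sigma> \<pi>\<close>.\<close>

lemma relation_retraction_invertible_quotient:
  assumes C: "pair_subspace C" and U: "subspace U" and "finite F"
    and succ: "\<And>w. w \<in> span (U \<union> F) \<Longrightarrow> \<exists>v\<in>span (U \<union> F). (w, v) \<in> C"
    and pred: "\<And>w. w \<in> span (U \<union> F) \<Longrightarrow> \<exists>v\<in>span (U \<union> F). (v, w) \<in> C"
    and U_succ: "\<And>u. u \<in> U \<Longrightarrow> \<exists>v\<in>U. (u, v) \<in> C"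
    and U_pred: "\<And>u. u \<in> U \<Longrightarrow> \<exists>v\<in>U. (v, u) \<in> C"
    and to_0: "\<And>w. w \<in> span (U \<union> F) \<Longrightarrow> (w, 0) \<in> C \<Longrightarrow> w \<in> U"
    and from_0: "\<And>w. w \<in> span (U \<union> F) \<Longrightarrow> (0, w) \<in> C \<Longrightarrow> w \<in> U"
    and J: "J 0 = {0}" "\<And>n. subspace (J n)" "\<And>n. J n \<subseteq> U" "mono J"
      "\<And>n u. u \<in> J (Suc n) \<Longrightarrow> \<exists>v\<in>J n. (u, v) \<in> C"
    and K: "K 0 = {0}" "\<And>n. subspace (K n)" "\<And>n. K n \<subseteq> U" "mono K"
      "\<And>n u. u \<in> K (Suc n) \<Longrightarrow> \<exists>v\<in>K n. (v, u) \<in> C"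
    and sum: "\<And>u. u \<in> U \<Longrightarrow> \<exists>x y. x \<in> (\<Union>n. J n) \<and> y \<in> (\<Union>n. K n) \<and> u = x + y"
  shows "\<exists>\<phi>. relation_retraction C U (span (U \<union> F)) \<phi>"
proof -
  define W where "W = span (U \<union> F)"
  have W: "subspace W" "U \<subseteq> W"
    by (auto simp: W_def intro: span_base)
  \<comment> \<open>The selection on \<open>W\<close> must also preserve \<open>U\<close>. It is
    built in two rounds: on \<open>U\<close> with values in \<open>U\<close>, extending the zero map
    on \<open>{0}\<close>, and then on \<open>W\<close>, extending the first map.\<close>
  have selection: "\<exists>s. lin s \<and> (\<forall>x\<in>W. s x \<in> W \<and> (x, s x) \<in> D) \<and> (\<forall>x\<in>U. s x \<in> U)"
    if D: "pair_subspace D" and total: "\<And>w. w \<in> W \<Longrightarrow> \<exists>v\<in>W. (w, v) \<in> D"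
      and U_total: "\<And>u. u \<in> U \<Longrightarrow> \<exists>v\<in>U. (u, v) \<in> D" for D
  proof -
    have D_W: "pair_subspace {(x, y). y \<in> A \<and> (x, y) \<in> D}" if "subspace A" for A
      using that D by (auto simp: pair_subspace_iff subspace_def)
    have "(x, 0) \<in> {(x, y). y \<in> U \<and> (x, y) \<in> D}" if "x \<in> {0}" for x
      using that U D by (simp add: subspace_0 pair_subspace_0)
    then have "\<exists>h. lin h \<and> (\<forall>x\<in>{0}. h x = 0) \<and> (\<forall>x\<in>U. (x, h x) \<in> {(x, y). y \<in> U \<and> (x, y) \<in> D})"
      using U_total U
      by (intro exists_linear_selection D_W lin_zero subspace_single_0) (auto simp: subspace_0)
    then obtain h where h: "lin h" "\<And>x. x \<in> U \<Longrightarrow> h x \<in> U \<and> (x, h x) \<in> D"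
      by auto
    have "\<exists>s. lin s \<and> (\<forall>x\<in>U. s x = h x) \<and> (\<forall>x\<in>W. (x, s x) \<in> {(x, y). y \<in> W \<and> (x, y) \<in> D})"
      using U W total[unfolded Bex_def] h by (intro exists_linear_selection D_W) auto
    then obtain s where "lin s" "\<forall>x\<in>U. s x = h x" "\<forall>x\<in>W. s x \<in> W \<and> (x, s x) \<in> D"
      by auto
    then show ?thesis
      using h(2) by (intro exI[of _ s]) auto
  qed
  obtain \<sigma> where \<sigma>: "lin \<sigma>" "\<And>x. x \<in> W \<Longrightarrow> \<sigma> x \<in> W" "\<And>x. x \<in> W \<Longrightarrow> (x, \<sigma> x) \<in> C"
    "\<And>x. x \<in> U \<Longrightarrow> \<sigma> x \<in> U"
    using selection[OF C] succ U_succ by (auto simp: W_def)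
  obtain \<tau> where \<tau>: "lin \<tau>" "\<And>x. x \<in> W \<Longrightarrow> \<tau> x \<in> W" "\<And>x. x \<in> W \<Longrightarrow> (\<tau> x, x) \<in> C"
    "\<And>x. x \<in> U \<Longrightarrow> \<tau> x \<in> U"
    using selection[of "C\<inverse>"] C pred U_pred by (auto simp: W_def pair_subspace_converse)
  \<comment> \<open>\<open>\<tau> (\<sigma> x)\<close> and \<open>x\<close> have the common
    successor \<open>\<sigma> x\<close>, so their difference has successor \<open>0\<close> and
    \<open>to_0\<close> applies.\<close>
  have \<tau>\<sigma>: "\<tau> (\<sigma> x) - x \<in> U" if "x \<in> W" for x
  proof -
    have "\<tau> (\<sigma> x) - x \<in> W"
      using that \<tau>(2) \<sigma>(2) W by (simp add: subspace_diff)
    moreover have "(\<tau> (\<sigma> x) - x, \<sigma> x - \<sigma> x) \<in> C"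
      using that \<tau> \<sigma> C by (intro pair_subspace_diff) auto
    ultimately show ?thesis
      using to_0 by (simp add: W_def)
  qed
  have "pair_subspace {(x, y). y \<in> U}"
    using U by (auto simp: pair_subspace_iff subspace_def)
  then have "\<exists>\<pi>. lin \<pi> \<and> (\<forall>x\<in>U. \<pi> x = x) \<and> (\<forall>x\<in>W. (x, \<pi> x) \<in> {(x, y). y \<in> U})"
    using U W by (intro exists_linear_selection) (auto intro: linI subspace_0)
  then obtain \<pi> where \<pi>: "lin \<pi>" "\<And>x. x \<in> U \<Longrightarrow> \<pi> x = x" "\<And>x. x \<in> W \<Longrightarrow> \<pi> x \<in> U"
    by auto
  \<comment> \<open>From \<open>(\<pi> x, \<sigma> (\<pi> x)) \<in> C\<close> follows
    \<open>(\<pi> x, \<pi> (\<sigma> x) + \<beta> x) \<in> C\<close>. A map \<open>c\<close> with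
    \<open>(c x, c (\<sigma> x) + \<beta> x) \<in> C\<close> can therefore be subtracted from
    \<open>\<pi>\<close> to remove the error.\<close>
  define \<beta> where "\<beta> x = \<sigma> (\<pi> x) - \<pi> (\<sigma> x)" for x
  have "lin \<beta>"
    unfolding \<beta>_def[abs_def]
    by (rule lin_minus[OF lin_compose[OF \<sigma>(1) \<pi>(1)] lin_compose[OF \<pi>(1) \<sigma>(1)]])
  moreover have "\<beta> x \<in> U" if "x \<in> W" for x
    unfolding \<beta>_def using that \<sigma> \<pi> U by (intro subspace_diff) auto
  moreover have "\<beta> x = 0" if "x \<in> U" for x
    using that \<sigma> \<pi> by (simp add: \<beta>_def)
  ultimately have \<beta>: "lin \<beta>" "\<And>x. x \<in> W \<Longrightarrow> \<beta> x \<in> U" "\<And>x. x \<in> U \<Longrightarrow> \<beta> x = 0"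
    by auto
  \<comment> \<open>By \<open>sum\<close>, \<open>\<beta> x\<close> has a part in the forward levels
    \<open>J\<close> and a part in the backward levels \<open>K\<close>; the part in
    \<open>J\<close> is to be chosen linearly and zero on \<open>U\<close>.\<close>
  let ?R = "{(x, y). y \<in> (\<Union>n. J n) \<and> \<beta> x - y \<in> (\<Union>n. K n)}"
  have "pair_subspace ?R"
    by (intro pair_subspace_split subspace_Union_chain J K \<beta>)
  moreover have "(x, 0) \<in> ?R" if "x \<in> U" for x
    using that \<beta>(3) J(2) K(2) by (auto simp: subspace_0)
  moreover have "\<exists>y. (x, y) \<in> ?R" if x: "x \<in> W" for x
  proof -
    obtain y z where "y \<in> (\<Union>n. J n)" "z \<in> (\<Union>n. K n)" "\<beta> x = y + z"
      using sum[OF \<beta>(2)[OF x]] by blast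
    then show ?thesis
      by (intro exI[of _ y]) simp
  qed
  ultimately have "\<exists>f. lin f \<and> (\<forall>x\<in>U. f x = 0) \<and> (\<forall>x\<in>W. (x, f x) \<in> ?R)"
    by (intro exists_linear_selection U W lin_zero)
  then obtain f where "lin f" and f_balls: "\<forall>x\<in>U. f x = 0" "\<forall>x\<in>W. (x, f x) \<in> ?R"
    by (elim exE conjE) (rule that)
  then have f: "lin f" "\<And>x. x \<in> U \<Longrightarrow> f x = 0"
    "\<And>x. x \<in> W \<Longrightarrow> f x \<in> (\<Union>n. J n)" "\<And>x. x \<in> W \<Longrightarrow> \<beta> x - f x \<in> (\<Union>n. K n)"
    by simp_all
  let ?g = "\<lambda>x. \<beta> x - f x"
  have g: "lin ?g" "\<And>x. x \<in> U \<Longrightarrow> ?g x = 0"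
    using \<beta>(3) f(2) by (auto intro: lin_minus[OF \<beta>(1) f(1)])
  have "\<exists>m. \<forall>x\<in>W. f x \<in> J m"
    using image_in_union_level[OF J(2,4) f(1) \<open>finite F\<close> U f(2) f(3)[unfolded W_def]]
    by (simp add: W_def)
  then obtain m where m: "\<And>x. x \<in> W \<Longrightarrow> f x \<in> J m"
    by metis
  have "\<exists>n. \<forall>x\<in>W. ?g x \<in> K n"
    using image_in_union_level[OF K(2,4) g(1) \<open>finite F\<close> U g(2) f(4)[unfolded W_def]]
    by (simp add: W_def)
  then obtain n where n: "\<And>x. x \<in> W \<Longrightarrow> ?g x \<in> K n"
    by metis
  have "\<exists>a. lin a \<and> (\<forall>x\<in>W. a x \<in> U) \<and> (\<forall>x\<in>U. a x = 0) \<and> (\<forall>x\<in>W. (a x, a (\<sigma> x) + f x) \<in> C)"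
    by (rule solve_coboundary_forward[OF C U W \<tau>(1,2,4) \<tau>\<sigma> J(1,2,3,5) f(1) m f(2)])
  then obtain a where a: "lin a" "\<forall>x\<in>W. a x \<in> U" "\<forall>x\<in>U. a x = 0"
    "\<forall>x\<in>W. (a x, a (\<sigma> x) + f x) \<in> C"
    by (elim exE conjE) (rule that)
  have "\<exists>a. lin a \<and> (\<forall>x\<in>W. a x \<in> U) \<and> (\<forall>x\<in>U. a x = 0) \<and> (\<forall>x\<in>W. (a x, a (\<sigma> x) + ?g x) \<in> C)"
    by (rule solve_coboundary_backward[OF C U W \<sigma>(1,2,4) K(1,2,3,5) g(1) n g(2)])
  then obtain b where b: "lin b" "\<forall>x\<in>W. b x \<in> U" "\<forall>x\<in>U. b x = 0"
    "\<forall>x\<in>W. (b x, b (\<sigma> x) + ?g x) \<in> C"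
    by (elim exE conjE) (rule that)
  \<comment> \<open>\<open>a + b\<close> solves the equation for \<open>f + ?g\<close>, which is
    \<open>\<beta>\<close>, so subtracting it cancels the obstruction.\<close>
  define \<phi> where "\<phi> x = \<pi> x - (a x + b x)" for x
  have "lin \<phi>"
    unfolding \<phi>_def[abs_def] by (rule lin_minus[OF \<pi>(1) lin_plus[OF a(1) b(1)]])
  moreover have "\<phi> x \<in> U" if "x \<in> W" for x
    using that \<pi>(3) a b U by (auto simp: \<phi>_def intro!: subspace_diff subspace_add)
  moreover have \<phi>_U: "\<phi> x = x" if "x \<in> U" for x
    using that \<pi> a b by (auto simp: \<phi>_def)
  moreover have "(\<phi> x, \<phi> y) \<in> C" if "x \<in> W" "y \<in> W" "(x, y) \<in> C" for x y
  proof -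
    have "(\<pi> x, \<sigma> (\<pi> x)) \<in> C"
      using \<sigma>(3) \<pi>(3)[OF that(1)] W by blast
    moreover have "(a x + b x, (a (\<sigma> x) + f x) + (b (\<sigma> x) + ?g x)) \<in> C"
      using that a b C by (intro pair_subspace_add) auto
    ultimately have "(\<phi> x, \<sigma> (\<pi> x) - ((a (\<sigma> x) + f x) + (b (\<sigma> x) + ?g x))) \<in> C"
      using C by (auto simp: \<phi>_def intro: pair_subspace_diff)
    then have step: "(\<phi> x, \<phi> (\<sigma> x)) \<in> C"
      by (simp add: \<phi>_def \<beta>_def algebra_simps)
    \<comment> \<open>An arbitrary successor \<open>y\<close> of \<open>x\<close> in
      \<open>W\<close> differs from \<open>\<sigma> x\<close> by a successor of \<open>0\<close>,
      which lies in \<open>U\<close> by \<open>from_0\<close> and is fixed by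
      \<open>\<phi>\<close>.\<close>
    have "(x - x, y - \<sigma> x) \<in> C"
      using that \<sigma> C by (intro pair_subspace_diff) auto
    moreover have "y - \<sigma> x \<in> W"
      using that \<sigma>(2) W by (simp add: subspace_diff)
    ultimately have "(0, y - \<sigma> x) \<in> C" "y - \<sigma> x \<in> U"
      using from_0 by (auto simp: W_def)
    then have "(0, \<phi> y - \<phi> (\<sigma> x)) \<in> C"
      using \<phi>_U lin_diff[OF \<open>lin \<phi>\<close>, of y "\<sigma> x"] by simp
    from pair_subspace_add[OF C step this] show ?thesis
      by simp
  qed
  ultimately show ?thesis
    unfolding relation_retraction_def W_def by blast
qed

end

section \<open>Bi-infinite chains and the sets they define\<close>

lemma bi_infinite_chain_converse:
  "bi_infinite_chain V (C\<inverse>) v \<longleftrightarrow> bi_infinite_chain V C (\<lambda>n. v (- n))"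
proof -
  have "(\<forall>n. v n \<in> V \<and> (v (n + 1), v n) \<in> C) \<longleftrightarrow> (\<forall>n. v (- n) \<in> V \<and> (v (- n), v (- (n + 1))) \<in> C)"
    (is "?L \<longleftrightarrow> ?R")
  proof
    assume ?L
    then have "v (- n) \<in> V \<and> (v (- (n + 1) + 1), v (- (n + 1))) \<in> C" for n
      by blast
    then show ?R
      by simp
  next
    assume R: ?R
    have "v n \<in> V \<and> (v (n + 1), v n) \<in> C" for n
      using R[rule_format, of "- n"] R[rule_format, of "- (n + 1)"] by (simp add: ac_simps)
    then show ?L
      by blast
  qed
  then show ?thesis
    by (simp add: bi_infinite_chain_def)
qed

lemma bi_infinite_chain_shift:
  "bi_infinite_chain V C v \<Longrightarrow> bi_infinite_chain V C (\<lambda>n. v (n + k))"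
proof -
  assume v: "bi_infinite_chain V C v"
  have "v (n + k) \<in> V \<and> (v (n + k), v (n + 1 + k)) \<in> C" for n
    using v[unfolded bi_infinite_chain_def, rule_format, of "n + k"] by (simp add: ac_simps)
  then show ?thesis
    by (simp add: bi_infinite_chain_def)
qed

lemma bi_infinite_chain_glue:
  fixes p q :: "nat \<Rightarrow> 'v"
  assumes "p 0 = q 0" "\<And>n. p n \<in> V" "\<And>n. q n \<in> V"
    and "\<And>n. (p (Suc n), p n) \<in> C" "\<And>n. (q n, q (Suc n)) \<in> C"
  shows "bi_infinite_chain V C (\<lambda>n. if n \<ge> 0 then q (nat n) else p (nat (- n)))"
proof -
  have "((if n \<ge> 0 then q (nat n) else p (nat (- n))),
    (if n + 1 \<ge> 0 then q (nat (n + 1)) else p (nat (- (n + 1))))) \<in> C" for n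
  proof (cases "n \<ge> 0")
    case True
    then show ?thesis
      using assms(5)[of "nat n"] by (simp add: nat_add_distrib)
  next
    case False
    \<comment> \<open>\<open>n + 1 = - m\<close>. For \<open>m = 0\<close> the pair crosses from the
      backward ray to the forward ray, and \<open>p 0 = q 0\<close> joins them.\<close>
    define m where "m = nat (- (n + 1))"
    have n: "n = - int (Suc m)"
      using False by (simp add: m_def)
    show ?thesis
      using assms(4)[of m] assms(1) by (cases m) (simp_all add: n nat_add_distrib)
  qed
  then show ?thesis
    using assms(2,3) by (auto simp: bi_infinite_chain_def)
qed

text \<open>The substitution of \<open>- n\<close> for \<open>n\<close>. Facts about
  \<open>rel_minus\<close> are read off from those about \<open>rel_plus\<close> for
  \<open>C\<inverse>\<close>.\<close>

lemma rel_minus_eq: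
  fixes V :: "'a::ab_group_add set"
  shows "rel_minus V C = rel_plus V (C\<inverse>)"
proof -
  have ev: "eventually (\<lambda>n. v (- n) = 0) at_top \<longleftrightarrow> eventually (\<lambda>n. v n = 0) at_bot"
    for v :: "int \<Rightarrow> 'a"
    unfolding eventually_at_top_linorder eventually_at_bot_linorder
    by (metis minus_le_iff minus_minus neg_le_iff_le)
  show ?thesis
  proof (intro subset_antisym subsetI)
    fix x assume "x \<in> rel_minus V C"
    then obtain v where "x = v 0" "bi_infinite_chain V C v" "eventually (\<lambda>n. v n = 0) at_bot"
      by (auto simp: rel_minus_def)
    then show "x \<in> rel_plus V (C\<inverse>)"
      using ev[of v]
      by (auto simp: rel_plus_def bi_infinite_chain_converse intro!: exI[of _ "\<lambda>n. v (- n)"])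
  next
    fix x assume "x \<in> rel_plus V (C\<inverse>)"
    then obtain v where "x = v 0" "bi_infinite_chain V (C\<inverse>) v" "eventually (\<lambda>n. v n = 0) at_top"
      by (auto simp: rel_plus_def)
    then show "x \<in> rel_minus V C"
      using ev[of "\<lambda>n. v (- n)"]
      by (auto simp: rel_minus_def bi_infinite_chain_converse intro!: exI[of _ "\<lambda>n. v (- n)"])
  qed
qed

text \<open>Filtration of \<open>rel_plus\<close> by the index from which the chain vanishes. It
  supplies the subspaces \<open>J\<close> (from \<open>C\<close>) and \<open>K\<close> (from
  \<open>C\<inverse>\<close>) of the coboundary equations. Vanishing starts at \<open>n\<close>
  itself, so level \<open>0\<close> is trivial.\<close>

definition plus_level :: "'v::ab_group_add set \<Rightarrow> ('v \<times> 'v) set \<Rightarrow> nat \<Rightarrow> 'v set" where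
  "plus_level V C n = {v 0 | v. bi_infinite_chain V C v \<and> (\<forall>k\<ge>int n. v k = 0)}"

lemma rel_plus_eq: "rel_plus V C = (\<Union>n. plus_level V C n)"
proof -
  have "eventually (\<lambda>n. v n = 0) at_top \<longleftrightarrow> (\<exists>n. \<forall>k\<ge>int n. v k = 0)" for v :: "int \<Rightarrow> 'a"
    unfolding eventually_at_top_linorder by (metis nat_le_iff order_trans order_refl)
  then show ?thesis
    by (auto simp: rel_plus_def plus_level_def)
qed

lemma mono_plus_level: "mono (plus_level V C)"
  unfolding mono_def plus_level_def by (auto intro: order_trans)

text \<open>Shifting a chain by one index makes it vanish one step earlier.\<close>

lemma plus_level_Suc:
  assumes "u \<in> plus_level V C (Suc n)"
  shows "\<exists>v\<in>plus_level V C n. (u, v) \<in> C"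
proof -
  obtain v where v: "u = v 0" "bi_infinite_chain V C v" "\<forall>k\<ge>int (Suc n). v k = 0"
    using assms by (auto simp: plus_level_def)
  have "v 1 \<in> plus_level V C n"
    unfolding plus_level_def using bi_infinite_chain_shift[OF v(2), of 1] v(3)
    by (auto intro!: exI[of _ "\<lambda>n. v (n + 1)"])
  moreover have "(v 0, v 1) \<in> C"
    using v(2)[unfolded bi_infinite_chain_def, rule_format, of 0] by simp
  ultimately show ?thesis
    using v by blast
qed

lemma plus_level_pred:
  assumes "u \<in> plus_level V C n"
  shows "\<exists>v\<in>plus_level V C (Suc n). (v, u) \<in> C"
proof -
  obtain v where v: "u = v 0" "bi_infinite_chain V C v" "\<forall>k\<ge>int n. v k = 0"
    using assms by (auto simp: plus_level_def)
  have "v (-1) \<in> plus_level V C (Suc n)"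
    unfolding plus_level_def using bi_infinite_chain_shift[OF v(2), of "-1"] v(3)
    by (auto intro!: exI[of _ "\<lambda>n. v (n + -1)"])
  moreover have "(v (-1), v 0) \<in> C"
    using v(2)[unfolded bi_infinite_chain_def, rule_format, of "-1"] by simp
  ultimately show ?thesis
    using v by blast
qed

lemma rel_plus_succ: "u \<in> rel_plus V C \<Longrightarrow> \<exists>v\<in>rel_plus V C. (u, v) \<in> C"
  unfolding rel_plus_eq using plus_level_Suc monoD[OF mono_plus_level]
  by (metis UN_iff UNIV_I le_SucI order_refl subsetD)

lemma rel_plus_pred: "u \<in> rel_plus V C \<Longrightarrow> \<exists>v\<in>rel_plus V C. (v, u) \<in> C"
  unfolding rel_plus_eq using plus_level_pred by (metis UN_iff UNIV_I)

lemma rel_sharp_succ: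
  assumes "u \<in> rel_sharp V C"
  shows "\<exists>v\<in>rel_sharp V C. (u, v) \<in> C"
proof -
  obtain v where v: "u = v 0" "bi_infinite_chain V C v"
    using assms by (auto simp: rel_sharp_def)
  have "v 1 \<in> rel_sharp V C"
    unfolding rel_sharp_def using bi_infinite_chain_shift[OF v(2), of 1]
    by (auto intro!: exI[of _ "\<lambda>n. v (n + 1)"])
  moreover have "(v 0, v 1) \<in> C"
    using v(2)[unfolded bi_infinite_chain_def, rule_format, of 0] by simp
  ultimately show ?thesis
    using v by blast
qed

lemma rel_sharp_converse: "rel_sharp V (C\<inverse>) = rel_sharp V C"
proof -
  have "x \<in> rel_sharp V (C\<inverse>)" if x: "x \<in> rel_sharp V C" for x and C :: "('a \<times> 'a) set"
  proof -
    obtain v where "x = v 0" "bi_infinite_chain V C v"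
      using x by (auto simp: rel_sharp_def)
    then show ?thesis
      by (auto simp: rel_sharp_def bi_infinite_chain_converse intro!: exI[of _ "\<lambda>n. v (- n)"])
  qed
  from this[of _ C] this[of _ "C\<inverse>"] show ?thesis
    by auto
qed

lemma rel_sharp_pred: "u \<in> rel_sharp V C \<Longrightarrow> \<exists>v\<in>rel_sharp V C. (v, u) \<in> C"
  using rel_sharp_succ[of u V "C\<inverse>"] by (simp add: rel_sharp_converse)

lemma rel_minus_succ: "u \<in> rel_minus V C \<Longrightarrow> \<exists>v\<in>rel_minus V C. (u, v) \<in> C"
  using rel_plus_pred[of u V "C\<inverse>"] by (simp add: rel_minus_eq)

text \<open>Dependent choice, where the conjunct \<open>n = 0 \<longrightarrow> x = w\<close> fixes
  the starting point.\<close>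

lemma iterated_successors:
  assumes "\<And>w. w \<in> W \<Longrightarrow> \<exists>v\<in>W. (w, v) \<in> C" and "w \<in> W"
  obtains q :: "nat \<Rightarrow> 'v" where "q 0 = w" "\<And>n. q n \<in> W" "\<And>n. (q n, q (Suc n)) \<in> C"
  using dependent_nat_choice[of "\<lambda>n x. x \<in> W \<and> (n = 0 \<longrightarrow> x = w)" "\<lambda>n x y. (x, y) \<in> C"] assms
  by (metis nat.distinct(1))

text \<open>Iterated successors and iterated predecessors, all inside \<open>W\<close>, are glued at
  \<open>w\<close>. Consequently an extension of \<open>rel_sharp\<close> on which \<open>C\<close>
  is total in both directions cannot be a proper one.\<close>

lemma subset_rel_sharp:
  assumes "\<And>w. w \<in> W \<Longrightarrow> \<exists>v\<in>W. (w, v) \<in> C" "\<And>w. w \<in> W \<Longrightarrow> \<exists>v\<in>W. (v, w) \<in> C" "W \<subseteq> V"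
  shows "W \<subseteq> rel_sharp V C"
proof
  fix w assume "w \<in> W"
  obtain q where q: "q 0 = w" "\<And>n. q n \<in> W" "\<And>n. (q n, q (Suc n)) \<in> C"
    using iterated_successors[OF assms(1) \<open>w \<in> W\<close>] by blast
  obtain p where p: "p 0 = w" "\<And>n. p n \<in> W" "\<And>n. (p (Suc n), p n) \<in> C"
    using iterated_successors[of W "C\<inverse>" w] assms(2) \<open>w \<in> W\<close> by auto
  let ?v = "\<lambda>n :: int. if n \<ge> 0 then q (nat n) else p (nat (- n))"
  have "bi_infinite_chain V C ?v"
    using p q assms(3) by (intro bi_infinite_chain_glue) auto
  moreover have "?v 0 = w"
    using q(1) by simp
  ultimately show "w \<in> rel_sharp V C"
    unfolding rel_sharp_def by (intro CollectI exI[of _ ?v]) simp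
qed

text \<open>The chain runs through \<open>W\<close> up to \<open>w\<close> and is \<open>0\<close>
  from index \<open>1\<close> on. Used for \<open>C\<close> and for \<open>C\<inverse>\<close>, this
  gives the conditions \<open>to_0\<close> and \<open>from_0\<close> for
  \<open>rel_flat\<close>.\<close>

lemma rel_plusI:
  assumes "\<And>w. w \<in> W \<Longrightarrow> \<exists>v\<in>W. (v, w) \<in> C" "W \<subseteq> V" "w \<in> W" "(w, 0) \<in> C" "(0, 0) \<in> C" "0 \<in> V"
  shows "w \<in> rel_plus V C"
proof -
  obtain p where p: "p 0 = w" "\<And>n. p n \<in> W" "\<And>n. (p (Suc n), p n) \<in> C"
    using iterated_successors[of W "C\<inverse>" w] assms(1,3) by auto
  let ?q = "\<lambda>n :: nat. if n = 0 then w else 0"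
  let ?v = "\<lambda>n :: int. if n \<ge> 0 then ?q (nat n) else p (nat (- n))"
  have "bi_infinite_chain V C ?v"
    using p assms(2-) by (intro bi_infinite_chain_glue) auto
  moreover have "eventually (\<lambda>n. ?v n = 0) at_top"
    using eventually_gt_at_top[of "0 :: int"] by eventually_elim auto
  ultimately show ?thesis
    unfolding rel_plus_def by (auto intro!: exI[of _ ?v])
qed

section \<open>Retractions onto the sharp and flat subspaces\<close>

context ambient_space
begin

lemma bi_infinite_chain_0: "subspace V \<Longrightarrow> pair_subspace C \<Longrightarrow> bi_infinite_chain V C (\<lambda>_. 0)"
  by (simp add: bi_infinite_chain_def subspace_0 pair_subspace_0)

lemma bi_infinite_chain_add:
  "\<lbrakk>subspace V; pair_subspace C; bi_infinite_chain V C v; bi_infinite_chain V C w\<rbrakk> \<Longrightarrow>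
    bi_infinite_chain V C (\<lambda>n. v n + w n)"
  by (simp add: bi_infinite_chain_def subspace_add pair_subspace_add)

lemma bi_infinite_chain_scale:
  "\<lbrakk>subspace V; pair_subspace C; bi_infinite_chain V C v\<rbrakk> \<Longrightarrow>
    bi_infinite_chain V C (\<lambda>n. c *s v n)"
  by (simp add: bi_infinite_chain_def subspace_scale pair_subspace_scale)

text \<open>The parameter \<open>P\<close> serves both \<open>rel_sharp\<close>, with the trivial
  condition, and \<open>plus_level\<close>, with vanishing from an index on.\<close>

lemma subspace_chain_values:
  assumes V: "subspace V" "pair_subspace C"
    and P: "P (\<lambda>_. 0)" "\<And>v w. P v \<Longrightarrow> P w \<Longrightarrow> P (\<lambda>n. v n + w n)" "\<And>c v. P v \<Longrightarrow> P (\<lambda>n. c *s v n)"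
  shows "subspace {v 0 | v. bi_infinite_chain V C v \<and> P v}"
proof (rule subspaceI)
  let ?S = "{v 0 | v. bi_infinite_chain V C v \<and> P v}"
  show "0 \<in> ?S"
    using bi_infinite_chain_0[OF V] P(1) by (auto intro!: exI[of _ "\<lambda>_. 0"])
  show "c *s x \<in> ?S" if "x \<in> ?S" for c x
    using that bi_infinite_chain_scale[OF V] P(3) by fastforce
  fix x y assume "x \<in> ?S" "y \<in> ?S"
  then obtain v w where "x = v 0" "bi_infinite_chain V C v" "P v"
    "y = w 0" "bi_infinite_chain V C w" "P w"
    by blast
  then show "x + y \<in> ?S"
    using bi_infinite_chain_add[OF V] P(2) by (auto intro!: exI[of _ "\<lambda>n. v n + w n"])
qed

lemma subspace_rel_sharp: "subspace V \<Longrightarrow> pair_subspace C \<Longrightarrow> subspace (rel_sharp V C)"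
  using subspace_chain_values[of V C "\<lambda>_. True"] by (simp add: rel_sharp_def)

lemma subspace_plus_level: "subspace V \<Longrightarrow> pair_subspace C \<Longrightarrow> subspace (plus_level V C n)"
  unfolding plus_level_def by (rule subspace_chain_values) auto

lemma subspace_rel_plus: "subspace V \<Longrightarrow> pair_subspace C \<Longrightarrow> subspace (rel_plus V C)"
  unfolding rel_plus_eq by (intro subspace_Union_chain subspace_plus_level mono_plus_level)

lemma subspace_rel_minus: "subspace V \<Longrightarrow> pair_subspace C \<Longrightarrow> subspace (rel_minus V C)"
  by (simp add: rel_minus_eq subspace_rel_plus pair_subspace_converse)

lemma subspace_rel_flat: "subspace V \<Longrightarrow> pair_subspace C \<Longrightarrow> subspace (rel_flat V C)"
  unfolding rel_flat_def by (intro subspace_sums subspace_rel_plus subspace_rel_minus)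

lemma plus_level_0:
  assumes "subspace V" "pair_subspace C"
  shows "plus_level V C 0 = {0}"
proof -
  have "plus_level V C 0 \<subseteq> {0}"
    by (auto simp: plus_level_def)
  then show ?thesis
    using subspace_0[OF subspace_plus_level[OF assms]] by blast
qed

lemma rel_sharp_subset: "rel_sharp V C \<subseteq> V"
  by (auto simp: rel_sharp_def bi_infinite_chain_def)

lemma rel_flat_subset: "subspace V \<Longrightarrow> rel_flat V C \<subseteq> V"
  by (auto simp: rel_flat_def rel_plus_def rel_minus_def bi_infinite_chain_def intro!: subspace_add)

lemma rel_flat_succ:
  assumes "pair_subspace C" "u \<in> rel_flat V C"
  shows "\<exists>v\<in>rel_flat V C. (u, v) \<in> C"
proof -
  obtain x y where xy: "u = x + y" "x \<in> rel_plus V C" "y \<in> rel_minus V C"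
    using assms(2) unfolding rel_flat_def by blast
  then obtain x' y' where "x' \<in> rel_plus V C" "(x, x') \<in> C" "y' \<in> rel_minus V C" "(y, y') \<in> C"
    using rel_plus_succ rel_minus_succ by blast
  then show ?thesis
    using pair_subspace_add[OF assms(1)] xy unfolding rel_flat_def by blast
qed

lemma rel_flat_converse:
  fixes V :: "'b set"
  shows "rel_flat V (C\<inverse>) = rel_flat V C"
proof -
  have "rel_flat V (D\<inverse>) \<subseteq> rel_flat V D" for D :: "('b \<times> 'b) set"
  proof
    fix u assume "u \<in> rel_flat V (D\<inverse>)"
    then obtain x y where "u = y + x" "x \<in> rel_minus V D" "y \<in> rel_plus V D"
      unfolding rel_flat_def rel_minus_eq converse_converse by (auto simp: add.commute)
    then show "u \<in> rel_flat V D"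
      unfolding rel_flat_def by blast
  qed
  from this[of C] this[of "C\<inverse>"] show ?thesis
    by simp
qed

lemma rel_flat_pred:
  assumes "pair_subspace C" "u \<in> rel_flat V C"
  shows "\<exists>v\<in>rel_flat V C. (v, u) \<in> C"
  using rel_flat_succ[of "C\<inverse>" u V] assms by (simp add: rel_flat_converse pair_subspace_converse)

lemma rel_plus_subset_flat:
  assumes "subspace V" "pair_subspace C"
  shows "rel_plus V C \<subseteq> rel_flat V C"
  using subspace_0[OF subspace_rel_minus[OF assms]] unfolding rel_flat_def by force

lemma rel_minus_subset_flat:
  assumes "subspace V" "pair_subspace C"
  shows "rel_minus V C \<subseteq> rel_flat V C"
  using subspace_0[OF subspace_rel_plus[OF assms]] unfolding rel_flat_def by force

text \<open>Once \<open>C\<close> is total in both directions on the extension, the extension equals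
  \<open>rel_sharp V C\<close> and the identity is a retraction.\<close>

lemma rel_sharp_retraction:
  assumes V: "subspace V" and C: "pair_subspace C" and F: "finite F" "F \<subseteq> V"
  shows "\<exists>\<phi>. relation_retraction C (rel_sharp V C) (span (rel_sharp V C \<union> F)) \<phi>"
proof (rule relation_retraction_finite_codim[OF C subspace_rel_sharp[OF V C] V rel_sharp_subset
      rel_sharp_succ rel_sharp_pred _ F])
  fix F assume "F \<subseteq> V"
    and succ: "\<And>w. w \<in> span (rel_sharp V C \<union> F) \<Longrightarrow> \<exists>v\<in>span (rel_sharp V C \<union> F). (w, v) \<in> C"
    and pred: "\<And>w. w \<in> span (rel_sharp V C \<union> F) \<Longrightarrow> \<exists>v\<in>span (rel_sharp V C \<union> F). (v, w) \<in> C"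
  have "span (rel_sharp V C \<union> F) \<subseteq> V"
    using V \<open>F \<subseteq> V\<close> rel_sharp_subset[of V C] by (intro span_minimal) auto
  then have "span (rel_sharp V C \<union> F) \<subseteq> rel_sharp V C"
    by (intro subset_rel_sharp succ pred)
  moreover have "lin (\<lambda>x. x)"
    by (rule linI) auto
  ultimately show "\<exists>\<phi>. relation_retraction C (rel_sharp V C) (span (rel_sharp V C \<union> F)) \<phi>"
    by (auto simp: relation_retraction_def intro!: exI[of _ "\<lambda>x. x"])
qed auto

text \<open>The core case is the one with invertible quotient, where the levels of \<open>C\<close>
  and of \<open>C\<inverse>\<close> exhaust the two summands of \<open>rel_flat\<close>.\<close>

lemma rel_flat_retraction:
  assumes V: "subspace V" and C: "pair_subspace C" and F: "finite F" "F \<subseteq> V"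
  shows "\<exists>\<phi>. relation_retraction C (rel_flat V C) (span (rel_flat V C \<union> F)) \<phi>"
proof (rule relation_retraction_finite_codim[OF C subspace_rel_flat[OF V C] V rel_flat_subset[OF V]
      rel_flat_succ[OF C] rel_flat_pred[OF C] _ F])
  let ?U = "rel_flat V C"
  fix F assume F: "finite F" "F \<subseteq> V"
    and succ: "\<And>w. w \<in> span (?U \<union> F) \<Longrightarrow> \<exists>v\<in>span (?U \<union> F). (w, v) \<in> C"
    and pred: "\<And>w. w \<in> span (?U \<union> F) \<Longrightarrow> \<exists>v\<in>span (?U \<union> F). (v, w) \<in> C"
  have W: "span (?U \<union> F) \<subseteq> V"
    using V F(2) rel_flat_subset[OF V] by (intro span_minimal) auto
  have C': "pair_subspace (C\<inverse>)"
    using C by (simp add: pair_subspace_converse)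
  \<comment> \<open>Such a \<open>w\<close> continues backwards inside the extension by
    \<open>pred\<close> and forwards by zeros, so it lies in \<open>rel_plus\<close>. The fact
    \<open>from_0\<close> is the same for the converse.\<close>
  have to_0: "w \<in> ?U" if "w \<in> span (?U \<union> F)" "(w, 0) \<in> C" for w
    using rel_plusI[OF pred W that] rel_plus_subset_flat[OF V C] V C
    by (auto simp: subspace_0 pair_subspace_0)
  have from_0: "w \<in> ?U" if "w \<in> span (?U \<union> F)" "(0, w) \<in> C" for w
    using rel_plusI[of "span (?U \<union> F)" "C\<inverse>" V w] succ W that rel_minus_subset_flat[OF V C] V C
    by (auto simp: subspace_0 pair_subspace_0 rel_minus_eq)
  have levels: "plus_level V C n \<subseteq> ?U" "plus_level V (C\<inverse>) n \<subseteq> ?U" for n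
    using rel_plus_subset_flat[OF V C] rel_minus_subset_flat[OF V C]
    unfolding rel_minus_eq rel_plus_eq by blast+
  show "\<exists>\<phi>. relation_retraction C ?U (span (?U \<union> F)) \<phi>"
  proof (rule relation_retraction_invertible_quotient[OF C subspace_rel_flat[OF V C] F(1) succ pred
        rel_flat_succ[OF C] rel_flat_pred[OF C] to_0 from_0 plus_level_0[OF V C]
        subspace_plus_level[OF V C] levels(1) mono_plus_level plus_level_Suc
        plus_level_0[OF V C'] subspace_plus_level[OF V C'] levels(2) mono_plus_level])
    show "\<exists>v\<in>plus_level V (C\<inverse>) n. (v, u) \<in> C" if "u \<in> plus_level V (C\<inverse>) (Suc n)" for n u
      using plus_level_Suc[OF that] by simp
    show "\<exists>x y. x \<in> (\<Union>n. plus_level V C n) \<and> y \<in> (\<Union>n. plus_level V (C\<inverse>) n) \<and> u = x + y"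
      if "u \<in> ?U" for u
      using that by (auto simp: rel_flat_def rel_minus_eq rel_plus_eq)
  qed
qed auto

end


section \<open>Tensor products and local retractions\<close>

lemma tensor_relators_cases [consumes 1]:
  assumes "c \<in> tensor_relators R N M"
  obtains
    (add_left) n n' m where "c = frag_of (n \<oplus>\<^bsub>N\<^esub> n', m) - frag_of (n, m) - frag_of (n', m)"
      "n \<in> carrier N" "n' \<in> carrier N" "m \<in> carrier M"
  | (add_right) n m m' where "c = frag_of (n, m \<oplus>\<^bsub>M\<^esub> m') - frag_of (n, m) - frag_of (n, m')"
      "n \<in> carrier N" "m \<in> carrier M" "m' \<in> carrier M"
  | (smult) n r m where "c = frag_of (r \<odot>\<^bsub>N\<^esub> n, m) - frag_of (n, r \<odot>\<^bsub>M\<^esub> m)"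
      "n \<in> carrier N" "r \<in> carrier R" "m \<in> carrier M"
  using assms unfolding tensor_relators_def
  by (elim UnE CollectE exE conjE) (rule that; assumption)+

lemma tensor_relators_subset:
  assumes "right_module R N" "left_module R M"
  shows "tensor_relators R N M \<subseteq> carrier (free_Abelian_group (carrier N \<times> carrier M))"
proof -
  interpret M: left_module R M by fact
  interpret N: right_module R N by fact
  let ?Z = "free_Abelian_group (carrier N \<times> carrier M)"
  have diff: "a - b \<in> carrier ?Z" if "a \<in> carrier ?Z" "b \<in> carrier ?Z" for a b
    using that subset_trans[OF keys_diff Un_least, of a _ b] by simp
  show ?thesis
  proof
    fix c assume "c \<in> tensor_relators R N M"
    then show "c \<in> carrier ?Z"
    proof (cases rule: tensor_relators_cases)
      case add_left
      show ?thesis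
        unfolding add_left(1) using add_left(2-4)
        by (intro diff) (simp_all add: keys_frag_of)
    next
      case add_right
      show ?thesis
        unfolding add_right(1) using add_right(2-4)
        by (intro diff) (simp_all add: keys_frag_of)
    next
      case smult
      show ?thesis
        unfolding smult(1) using smult(2-4)
        by (intro diff) (simp_all add: keys_frag_of M.smult_closed N.smult_closed)
    qed
  qed
qed

locale tensor_pair = N: right_module R N + M: left_module R M
  for R :: "('r, 'q) ring_scheme" and N :: "('r, 'n) module" and M :: "('r, 'm) module"
begin

abbreviation Z where "Z \<equiv> free_Abelian_group (carrier N \<times> carrier M)"
abbreviation T where "T \<equiv> tensor_subgroup R N M"

lemma relators_subset: "tensor_relators R N M \<subseteq> carrier Z"
  by (rule tensor_relators_subset[OF N.right_module_axioms M.left_module_axioms])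

lemma subgroup_T: "subgroup T Z"
  unfolding tensor_subgroup_def
  by (rule group.generate_is_subgroup[OF group_free_Abelian_group relators_subset])

lemma normal_T: "T \<lhd> Z"
  by (rule comm_group.normal_iff_subgroup[OF abelian_free_Abelian_group, THEN iffD2, OF subgroup_T])

lemma keys_T: "c \<in> T \<Longrightarrow> Poly_Mapping.keys c \<subseteq> carrier N \<times> carrier M"
  using subsetD[OF subgroup.subset[OF subgroup_T], of c]
  by (simp only: carrier_free_Abelian_group_iff)

lemma T_0: "0 \<in> T"
  using subgroup.one_closed[OF subgroup_T] by simp

lemma T_add: "c \<in> T \<Longrightarrow> d \<in> T \<Longrightarrow> c + d \<in> T"
  using subgroup.m_closed[OF subgroup_T] by simp

lemma T_minus: "c \<in> T \<Longrightarrow> - c \<in> T"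
  using subgroup.m_inv_closed[OF subgroup_T, of c] keys_T[of c] by simp

lemma T_diff: "c \<in> T \<Longrightarrow> d \<in> T \<Longrightarrow> c - d \<in> T"
  using T_add[of c "- d"] T_minus[of d] by simp

lemma relators_T: "c \<in> tensor_relators R N M \<Longrightarrow> c \<in> T"
  unfolding tensor_subgroup_def by (rule generate.incl)

lemma relator_add_left:
  "\<lbrakk>n \<in> carrier N; n' \<in> carrier N; m \<in> carrier M\<rbrakk> \<Longrightarrow>
    frag_of (n \<oplus>\<^bsub>N\<^esub> n', m) - frag_of (n, m) - frag_of (n', m) \<in> T"
  by (rule relators_T, unfold tensor_relators_def, rule UnI1, rule UnI1, rule CollectI, (rule exI)+,
      rule conjI, rule refl) simp

lemma relator_add_right:
  "\<lbrakk>n \<in> carrier N; m \<in> carrier M; m' \<in> carrier M\<rbrakk> \<Longrightarrow>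
    frag_of (n, m \<oplus>\<^bsub>M\<^esub> m') - frag_of (n, m) - frag_of (n, m') \<in> T"
  by (rule relators_T, unfold tensor_relators_def, rule UnI1, rule UnI2, rule CollectI, (rule exI)+,
      rule conjI, rule refl) simp

lemma relator_smult:
  "\<lbrakk>n \<in> carrier N; r \<in> carrier R; m \<in> carrier M\<rbrakk> \<Longrightarrow>
    frag_of (r \<odot>\<^bsub>N\<^esub> n, m) - frag_of (n, r \<odot>\<^bsub>M\<^esub> m) \<in> T"
  by (rule relators_T, unfold tensor_relators_def, rule UnI2, rule CollectI, (rule exI)+,
      rule conjI, rule refl) simp

text \<open>Induction over the generated subgroup in additive form: inverses of relators become
  negatives, products become sums.\<close>

lemma T_induct [consumes 1, case_names zero add_left add_right smult minus add]:
  assumes "c \<in> T" "P 0"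
    and "\<And>n n' m. \<lbrakk>n \<in> carrier N; n' \<in> carrier N; m \<in> carrier M\<rbrakk> \<Longrightarrow>
      P (frag_of (n \<oplus>\<^bsub>N\<^esub> n', m) - frag_of (n, m) - frag_of (n', m))"
    and "\<And>n m m'. \<lbrakk>n \<in> carrier N; m \<in> carrier M; m' \<in> carrier M\<rbrakk> \<Longrightarrow>
      P (frag_of (n, m \<oplus>\<^bsub>M\<^esub> m') - frag_of (n, m) - frag_of (n, m'))"
    and "\<And>n r m. \<lbrakk>n \<in> carrier N; r \<in> carrier R; m \<in> carrier M\<rbrakk> \<Longrightarrow>
      P (frag_of (r \<odot>\<^bsub>N\<^esub> n, m) - frag_of (n, r \<odot>\<^bsub>M\<^esub> m))"
    and "\<And>c. P c \<Longrightarrow> P (- c)" "\<And>c d. P c \<Longrightarrow> P d \<Longrightarrow> P (c + d)"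
  shows "P c"
proof -
  have relators: "P c" if "c \<in> tensor_relators R N M" for c
    using that
  proof (cases rule: tensor_relators_cases)
    case add_left
    show ?thesis
      unfolding add_left(1) by (rule assms(3)[OF add_left(2-4)])
  next
    case add_right
    show ?thesis
      unfolding add_right(1) by (rule assms(4)[OF add_right(2-4)])
  next
    case smult
    show ?thesis
      unfolding smult(1) by (rule assms(5)[OF smult(2-4)])
  qed
  show ?thesis
    using assms(1) unfolding tensor_subgroup_def
  proof induction
    case one
    show ?case
      using assms(2) by simp
  next
    case (incl c)
    then show ?case
      by (rule relators)
  next
    case (inv c)
    have "inv\<^bsub>Z\<^esub> c = - c"
      using subsetD[OF relators_subset inv]
      by (intro inv_free_Abelian_group) (simp only: carrier_free_Abelian_group_iff)
    then show ?case
      using assms(6)[OF relators[OF inv]] by simp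
  next
    case (eng c d)
    then show ?case
      using assms(7)[of c d] by simp
  qed
qed

lemma coset_eq: "T #>\<^bsub>Z\<^esub> c = (\<lambda>h. h + c) ` T"
  by (auto simp: r_coset_def)

lemma coset_eq_iff: "T #>\<^bsub>Z\<^esub> c = T #>\<^bsub>Z\<^esub> d \<longleftrightarrow> c - d \<in> T"
proof
  assume "T #>\<^bsub>Z\<^esub> c = T #>\<^bsub>Z\<^esub> d"
  then have "0 + c \<in> (\<lambda>h. h + d) ` T"
    using T_0 unfolding coset_eq by blast
  then show "c - d \<in> T"
    by auto
next
  assume cd: "c - d \<in> T"
  have "h + c \<in> (\<lambda>h. h + d) ` T" if "h \<in> T" for h
    using T_add[OF that cd] by (intro image_eqI[of _ _ "h + (c - d)"]) auto
  moreover have "h + d \<in> (\<lambda>h. h + c) ` T" if "h \<in> T" for h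
    using T_diff[OF that cd] by (intro image_eqI[of _ _ "h - (c - d)"]) auto
  ultimately show "T #>\<^bsub>Z\<^esub> c = T #>\<^bsub>Z\<^esub> d"
    unfolding coset_eq by blast
qed

lemma coset_eq_T_iff: "T #>\<^bsub>Z\<^esub> c = T \<longleftrightarrow> c \<in> T"
proof -
  have "T #>\<^bsub>Z\<^esub> 0 = T"
    by (simp add: coset_eq)
  then show ?thesis
    using coset_eq_iff[of c 0] by simp
qed

lemma group_tensor_product: "group (tensor_product R N M)"
  unfolding tensor_product_def by (rule normal.factorgroup_is_group[OF normal_T])

lemma carrier_tensor_product:
  "carrier (tensor_product R N M) =
    (\<lambda>c. T #>\<^bsub>Z\<^esub> c) ` {c. Poly_Mapping.keys c \<subseteq> carrier N \<times> carrier M}"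
  by (auto simp: tensor_product_def FactGroup_def RCOSETS_def)

lemma one_tensor_product: "\<one>\<^bsub>tensor_product R N M\<^esub> = T"
  by (simp add: tensor_product_def FactGroup_def)

lemma mult_tensor_product:
  assumes "Poly_Mapping.keys c \<subseteq> carrier N \<times> carrier M" "Poly_Mapping.keys d \<subseteq> carrier N \<times> carrier M"
  shows "(T #>\<^bsub>Z\<^esub> c) \<otimes>\<^bsub>tensor_product R N M\<^esub> (T #>\<^bsub>Z\<^esub> d) = T #>\<^bsub>Z\<^esub> (c + d)"
  using normal.rcos_sum[OF normal_T, of c d] assms by (simp add: tensor_product_def FactGroup_def)

end

section \<open>Induced maps on tensor products\<close>

text \<open>The map on formal sums that underlies \<open>tensor_map\<close>. It makes sense for any
  function \<open>f\<close>, so set-theoretic sections can be pushed as well, and arguments take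
  place on representatives before passing to cosets.\<close>

definition tensor_push :: "('a \<Rightarrow> 'b) \<Rightarrow> ('n \<times> 'a \<Rightarrow>\<^sub>0 int) \<Rightarrow> ('n \<times> 'b \<Rightarrow>\<^sub>0 int)" where
  "tensor_push f = frag_extend (\<lambda>(n, m). frag_of (n, f m))"

lemma tensor_push_simps [simp]:
  "tensor_push f 0 = 0"
  "tensor_push f (frag_of (n, m)) = frag_of (n, f m)"
  "tensor_push f (- c) = - tensor_push f c"
  "tensor_push f (c + d) = tensor_push f c + tensor_push f d"
  "tensor_push f (c - d) = tensor_push f c - tensor_push f d"
  by (simp_all add: tensor_push_def frag_extend_minus frag_extend_add frag_extend_diff)

lemma keys_tensor_push:
  assumes "Poly_Mapping.keys c \<subseteq> A \<times> B" "f ` B \<subseteq> B'"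
  shows "Poly_Mapping.keys (tensor_push f c) \<subseteq> A \<times> B'"
  using assms(1)
proof (rule free_Abelian_group_induct)
  fix x y :: "'a \<times> 'b \<Rightarrow>\<^sub>0 int"
  assume "Poly_Mapping.keys (tensor_push f x) \<subseteq> A \<times> B'" "Poly_Mapping.keys (tensor_push f y) \<subseteq> A \<times> B'"
  then show "Poly_Mapping.keys (tensor_push f (x - y)) \<subseteq> A \<times> B'"
    using keys_diff[of "tensor_push f x" "tensor_push f y"] by auto
qed (use assms(2) in \<open>auto simp: keys_frag_of\<close>)

lemma tensor_push_compose:
  assumes "Poly_Mapping.keys c \<subseteq> A \<times> B" "\<And>x. x \<in> B \<Longrightarrow> g (f x) = h x"
  shows "tensor_push g (tensor_push f c) = tensor_push h c"
  using assms(1) by (rule free_Abelian_group_induct) (use assms(2) in auto)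

lemma tensor_push_ident:
  assumes "Poly_Mapping.keys c \<subseteq> A \<times> B" "\<And>x. x \<in> B \<Longrightarrow> f x = x"
  shows "tensor_push f c = c"
  using assms(1) by (rule free_Abelian_group_induct) (use assms(2) in auto)


lemma linear_over_closed: "linear_over R M M' f \<Longrightarrow> x \<in> carrier M \<Longrightarrow> f x \<in> carrier M'"
  by (auto simp: linear_over_def hom_def)

lemma linear_over_add:
  "\<lbrakk>linear_over R M M' f; x \<in> carrier M; y \<in> carrier M\<rbrakk> \<Longrightarrow> f (x \<oplus>\<^bsub>M\<^esub> y) = f x \<oplus>\<^bsub>M'\<^esub> f y"
  by (auto simp: linear_over_def hom_def)

lemma linear_over_smult:
  "\<lbrakk>linear_over R M M' f; r \<in> carrier R; x \<in> carrier M\<rbrakk> \<Longrightarrow> f (r \<odot>\<^bsub>M\<^esub> x) = r \<odot>\<^bsub>M'\<^esub> f x"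
  by (auto simp: linear_over_def)

text \<open>A linear \<open>f\<close> carries each relator to a relator of the same kind.\<close>

lemma tensor_push_subgroup:
  assumes "right_module R N" "left_module R M" "left_module R M'"
    and f: "linear_over R M M' f" and "c \<in> tensor_subgroup R N M"
  shows "tensor_push f c \<in> tensor_subgroup R N M'"
proof -
  interpret M: tensor_pair R N M
    by (intro tensor_pair.intro assms)
  interpret M': tensor_pair R N M'
    by (intro tensor_pair.intro assms)
  note f_rules = linear_over_closed[OF f] linear_over_add[OF f] linear_over_smult[OF f]
  show ?thesis
    using assms(5)
    by (induction rule: M.T_induct)
      (simp_all add: f_rules M'.T_0 M'.T_minus M'.T_add M'.relator_add_left M'.relator_add_right
        M'.relator_smult)
qed

text \<open>\<open>tensor_map\<close> takes the only element of an image. That image is a singleton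
  because representatives of one coset differ by a relation, and \<open>tensor_push f\<close> sends
  relations to relations.\<close>

lemma tensor_map_coset:
  assumes "right_module R N" "left_module R M" "left_module R M'"
    and f: "linear_over R M M' f"
  shows "tensor_map R N M' f
      (tensor_subgroup R N M #>\<^bsub>free_Abelian_group (carrier N \<times> carrier M)\<^esub> c) =
    tensor_subgroup R N M' #>\<^bsub>free_Abelian_group (carrier N \<times> carrier M')\<^esub> tensor_push f c"
proof -
  interpret M: tensor_pair R N M
    by (intro tensor_pair.intro assms)
  interpret M': tensor_pair R N M'
    by (intro tensor_pair.intro assms)
  have "M'.T #>\<^bsub>M'.Z\<^esub> tensor_push f (h + c) = M'.T #>\<^bsub>M'.Z\<^esub> tensor_push f c" if "h \<in> M.T" for h
    using tensor_push_subgroup[OF assms that] by (simp add: M'.coset_eq_iff)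
  then have "(\<lambda>c. M'.T #>\<^bsub>M'.Z\<^esub> tensor_push f c) ` (M.T #>\<^bsub>M.Z\<^esub> c) = {M'.T #>\<^bsub>M'.Z\<^esub> tensor_push f c}"
    unfolding M.coset_eq using M.T_0 by (auto simp: image_image)
  then show ?thesis
    by (simp add: tensor_map_def tensor_push_def)
qed

lemma tensor_map_hom:
  assumes "right_module R N" "left_module R M" "left_module R M'"
    and f: "linear_over R M M' f"
  shows "tensor_map R N M' f \<in> hom (tensor_product R N M) (tensor_product R N M')"
proof -
  interpret M: tensor_pair R N M
    by (intro tensor_pair.intro assms)
  interpret M': tensor_pair R N M'
    by (intro tensor_pair.intro assms)
  have keys: "Poly_Mapping.keys (tensor_push f c) \<subseteq> carrier N \<times> carrier M'"
    if "Poly_Mapping.keys c \<subseteq> carrier N \<times> carrier M" for c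
    using that linear_over_closed[OF f] by (intro keys_tensor_push) auto
  show ?thesis
    unfolding hom_def M.carrier_tensor_product M'.carrier_tensor_product
    using keys
    by (auto simp: tensor_map_coset[OF assms] M.mult_tensor_product M'.mult_tensor_product
        simp del: carrier_free_Abelian_group_iff)
qed

section \<open>Right exactness of the tensor product\<close>

text \<open>The difference of \<open>m\<close> and \<open>m'\<close> is killed by \<open>g\<close>,
  hence comes from \<open>L\<close>.\<close>

lemma fibre_section:
  assumes exact: "short_exact_modules R L M Q f g"
    and "m \<in> carrier M" "m' \<in> carrier M" "g m = g m'"
  shows "\<exists>l\<in>carrier L. m = m' \<oplus>\<^bsub>M\<^esub> f l"
proof -
  have M: "left_module R M" and Q: "left_module R Q" and g: "linear_over R M Q g"
    and ker: "f ` carrier L = kernel (add_monoid M) (add_monoid Q) g"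
    using exact by (auto simp: short_exact_modules_def short_exact_def)
  interpret M: left_module R M
    by fact
  interpret Q: left_module R Q
    by fact
  interpret g: group_hom "add_monoid M" "add_monoid Q" g
    using g M.a_group Q.a_group by (simp add: group_hom_def group_hom_axioms_def linear_over_def)
  have "g (\<ominus>\<^bsub>M\<^esub> m' \<oplus>\<^bsub>M\<^esub> m) = \<zero>\<^bsub>Q\<^esub>"
    using assms g.hom_inv[of m'] linear_over_add[OF g] linear_over_closed[OF g]
    by (simp add: a_inv_def[symmetric] Q.l_neg)
  then have "\<ominus>\<^bsub>M\<^esub> m' \<oplus>\<^bsub>M\<^esub> m \<in> f ` carrier L"
    using assms by (simp add: ker kernel_def)
  then obtain l where l: "l \<in> carrier L" "f l = \<ominus>\<^bsub>M\<^esub> m' \<oplus>\<^bsub>M\<^esub> m"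
    by auto
  then have "m' \<oplus>\<^bsub>M\<^esub> f l = m"
    using assms by (simp add: M.r_neg2)
  with l show ?thesis
    by blast
qed

text \<open>A set-theoretic section \<open>s\<close> of \<open>g\<close> is linear up to elements of the image of \<open>f\<close>, so it
  inverts \<open>N \<otimes> g\<close> modulo the image of \<open>N \<otimes> f\<close>.\<close>

lemma tensor_middle_exact:
  assumes N: "right_module R N" and exact: "short_exact_modules R L M Q f g"
    and c: "Poly_Mapping.keys c \<subseteq> carrier N \<times> carrier M"
    and "tensor_push g c \<in> tensor_subgroup R N Q"
  shows "\<exists>d. Poly_Mapping.keys d \<subseteq> carrier N \<times> carrier L \<and> c - tensor_push f d \<in> tensor_subgroup R N M"
proof -
  have modules: "left_module R L" "left_module R M" "left_module R Q"
    and f: "linear_over R L M f" and g: "linear_over R M Q g"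
    and surj: "g ` carrier M = carrier Q"
    using exact by (auto simp: short_exact_modules_def short_exact_def epi_def)
  interpret L: tensor_pair R N L
    by (intro tensor_pair.intro N modules)
  interpret M: tensor_pair R N M
    by (intro tensor_pair.intro N modules)
  interpret Q: tensor_pair R N Q
    by (intro tensor_pair.intro N modules)
  \<comment> \<open>The formal sums that agree, modulo relations, with one pushed forward from
    \<open>L\<close>. The goal is \<open>c \<in> S\<close>.\<close>
  define S where "S = {c. \<exists>d. Poly_Mapping.keys d \<subseteq> carrier N \<times> carrier L \<and> c - tensor_push f d \<in> M.T}"
  have T_S: "c \<in> S" if "c \<in> M.T" for c
    using that unfolding S_def by (intro CollectI exI[of _ 0]) simp
  have S_add: "c + d \<in> S" if cd: "c \<in> S" "d \<in> S" for c d
  proof -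
    obtain c' d' where "Poly_Mapping.keys c' \<subseteq> carrier N \<times> carrier L" "c - tensor_push f c' \<in> M.T"
      "Poly_Mapping.keys d' \<subseteq> carrier N \<times> carrier L" "d - tensor_push f d' \<in> M.T"
      using cd unfolding S_def by blast
    then have "Poly_Mapping.keys (c' + d') \<subseteq> carrier N \<times> carrier L"
      "(c + d) - tensor_push f (c' + d') \<in> M.T"
      using keys_add[of c' d'] M.T_add[of "c - tensor_push f c'" "d - tensor_push f d'"]
      by (auto simp: algebra_simps)
    then show ?thesis
      unfolding S_def by blast
  qed
  have S_minus: "- c \<in> S" if cd: "c \<in> S" for c
  proof -
    obtain c' where "Poly_Mapping.keys c' \<subseteq> carrier N \<times> carrier L" "c - tensor_push f c' \<in> M.T"
      using cd unfolding S_def by blast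
    then have "Poly_Mapping.keys (- c') \<subseteq> carrier N \<times> carrier L" "(- c) - tensor_push f (- c') \<in> M.T"
      using M.T_minus[of "c - tensor_push f c'"] by (auto simp: algebra_simps)
    then show ?thesis
      unfolding S_def by blast
  qed
  have S_diff: "c - d \<in> S" if "c \<in> S" "d \<in> S" for c d
    using S_add[OF that(1) S_minus[OF that(2)]] by simp
  \<comment> \<open>Changing \<open>m\<close> within a fibre of \<open>g\<close> costs only an
    element \<open>n \<otimes> f l\<close>.\<close>
  have S_shift: "frag_of (n, m) - frag_of (n, m') \<in> S"
    if n: "n \<in> carrier N" and m: "m \<in> carrier M" "m' \<in> carrier M" "g m = g m'" for n m m'
  proof -
    obtain l where l: "l \<in> carrier L" "m = m' \<oplus>\<^bsub>M\<^esub> f l"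
      using fibre_section[OF exact m] by blast
    have "(frag_of (n, m) - frag_of (n, m')) - tensor_push f (frag_of (n, l)) \<in> M.T"
      using M.relator_add_right[OF n m(2) linear_over_closed[OF f l(1)]] by (simp add: l(2))
    moreover have "Poly_Mapping.keys (frag_of (n, l)) \<subseteq> carrier N \<times> carrier L"
      using n l by (simp add: keys_frag_of)
    ultimately show ?thesis
      unfolding S_def by blast
  qed
  define s where "s = inv_into (carrier M) g"
  have s: "s q \<in> carrier M" "g (s q) = q" if "q \<in> carrier Q" for q
    using that surj by (auto simp: s_def inv_into_into f_inv_into_f)
  have s_g: "g (s (g m)) = g m" "s (g m) \<in> carrier M" if "m \<in> carrier M" for m
    using that s[of "g m"] linear_over_closed[OF g] by auto
  \<comment> \<open>Relators of \<open>Q\<close> lift along \<open>s\<close> to relators of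
    \<open>M\<close> up to changes within fibres: \<open>s\<close> of a sum and the sum of the
    values of \<open>s\<close> have the same image under \<open>g\<close>, and likewise for
    multiples by \<open>r\<close>.\<close>
  have s_T: "tensor_push s e \<in> S" if "e \<in> Q.T" for e
    using that
  proof (induction rule: Q.T_induct)
    case zero
    then show ?case
      by (simp add: T_S M.T_0)
  next
    case (add_left n n' q)
    then show ?case
      using M.relator_add_left[of n n' "s q"] s by (simp add: T_S)
  next
    case (add_right n q q')
    then have "frag_of (n, s (q \<oplus>\<^bsub>Q\<^esub> q')) - frag_of (n, s q \<oplus>\<^bsub>M\<^esub> s q') \<in> S"
      by (intro S_shift) (simp_all add: s linear_over_add[OF g])
    from S_add[OF this T_S[OF M.relator_add_right[of n "s q" "s q'"]]] add_right show ?case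
      by (simp add: s algebra_simps)
  next
    case (smult n r q)
    then have "frag_of (n, s (r \<odot>\<^bsub>Q\<^esub> q)) - frag_of (n, r \<odot>\<^bsub>M\<^esub> s q) \<in> S"
      by (intro S_shift) (simp_all add: s linear_over_smult[OF g] M.M.smult_closed Q.M.smult_closed)
    from S_diff[OF T_S[OF M.relator_smult[of n r "s q"]] this] smult show ?case
      by (simp add: s algebra_simps)
  next
    case (minus c)
    then show ?case
      by (simp add: S_minus)
  next
    case (add c d)
    then show ?case
      by (simp add: S_add)
  qed
  \<comment> \<open>\<open>s (g m)\<close> and \<open>m\<close> lie in one fibre. Adding the image
    under \<open>s\<close> of the relation \<open>tensor_push g c\<close> then leaves
    \<open>c\<close> itself.\<close>
  have "c - tensor_push s (tensor_push g c) \<in> S"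
    using c
  proof (rule free_Abelian_group_induct)
    show "0 - tensor_push s (tensor_push g 0) \<in> S"
      by (simp add: T_S M.T_0)
    fix x y
    assume "x - tensor_push s (tensor_push g x) \<in> S" "y - tensor_push s (tensor_push g y) \<in> S"
    from S_diff[OF this] show "x - y - tensor_push s (tensor_push g (x - y)) \<in> S"
      by (simp add: algebra_simps)
  next
    fix a assume "a \<in> carrier N \<times> carrier M"
    then show "frag_of a - tensor_push s (tensor_push g (frag_of a)) \<in> S"
      using s_g by (auto intro!: S_shift)
  qed
  from S_add[OF this s_T[OF assms(4)]] show ?thesis
    unfolding S_def by simp
qed

text \<open>Tensoring is right exact for every \<open>N\<close>, so injectivity on the left, phrased
  by \<open>inj\<close> on formal sums, is all that purity has to provide.\<close>

lemma tensor_short_exact: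
  assumes N: "right_module R N" and exact: "short_exact_modules R L M Q f g"
    and inj: "\<And>c. \<lbrakk>Poly_Mapping.keys c \<subseteq> carrier N \<times> carrier L; tensor_push f c \<in> tensor_subgroup R N M\<rbrakk> \<Longrightarrow>
      c \<in> tensor_subgroup R N L"
  shows "short_exact (tensor_product R N L) (tensor_product R N M) (tensor_product R N Q)
    (tensor_map R N M f) (tensor_map R N Q g)"
proof -
  have modules: "left_module R L" "left_module R M" "left_module R Q"
    and f: "linear_over R L M f" and g: "linear_over R M Q g"
    and surj: "g ` carrier M = carrier Q"
    and ker: "f ` carrier L = kernel (add_monoid M) (add_monoid Q) g"
    using exact by (auto simp: short_exact_modules_def short_exact_def epi_def)
  interpret L: tensor_pair R N L
    by (intro tensor_pair.intro N modules)
  interpret M: tensor_pair R N M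
    by (intro tensor_pair.intro N modules)
  interpret Q: tensor_pair R N Q
    by (intro tensor_pair.intro N modules)
  note map_f = tensor_map_coset[OF N modules(1,2) f]
  note map_g = tensor_map_coset[OF N modules(2,3) g]
  have keys_f: "Poly_Mapping.keys (tensor_push f c) \<subseteq> carrier N \<times> carrier M"
    if "Poly_Mapping.keys c \<subseteq> carrier N \<times> carrier L" for c
    using that linear_over_closed[OF f] by (intro keys_tensor_push) auto
  have keys_g: "Poly_Mapping.keys (tensor_push g c) \<subseteq> carrier N \<times> carrier Q"
    if "Poly_Mapping.keys c \<subseteq> carrier N \<times> carrier M" for c
    using that linear_over_closed[OF g] by (intro keys_tensor_push) auto
  have "inj_on (tensor_map R N M f) (carrier (tensor_product R N L))"
  proof (rule inj_onI)
    fix x y assume "x \<in> carrier (tensor_product R N L)" "y \<in> carrier (tensor_product R N L)"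
    then obtain c d where c: "x = L.T #>\<^bsub>L.Z\<^esub> c" "Poly_Mapping.keys c \<subseteq> carrier N \<times> carrier L"
      and d: "y = L.T #>\<^bsub>L.Z\<^esub> d" "Poly_Mapping.keys d \<subseteq> carrier N \<times> carrier L"
      unfolding L.carrier_tensor_product by auto
    assume "tensor_map R N M f x = tensor_map R N M f y"
    then have "tensor_push f (c - d) \<in> M.T"
      by (simp add: c d map_f M.coset_eq_iff)
    moreover have "Poly_Mapping.keys (c - d) \<subseteq> carrier N \<times> carrier L"
      using c(2) d(2) keys_diff[of c d] by blast
    ultimately show "x = y"
      using inj by (simp add: c d L.coset_eq_iff)
  qed
  moreover have "tensor_map R N Q g ` carrier (tensor_product R N M) = carrier (tensor_product R N Q)"
  proof
    show "tensor_map R N Q g ` carrier (tensor_product R N M) \<subseteq> carrier (tensor_product R N Q)"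
      using tensor_map_hom[OF N modules(2,3) g] by (auto simp: hom_def)
    show "carrier (tensor_product R N Q) \<subseteq> tensor_map R N Q g ` carrier (tensor_product R N M)"
    proof
      fix x assume "x \<in> carrier (tensor_product R N Q)"
      then obtain c where c: "x = Q.T #>\<^bsub>Q.Z\<^esub> c" "Poly_Mapping.keys c \<subseteq> carrier N \<times> carrier Q"
        unfolding Q.carrier_tensor_product by auto
      \<comment> \<open>A set-theoretic section suffices here, since surjectivity is checked on
        representatives.\<close>
      let ?s = "inv_into (carrier M) g"
      have "tensor_push g (tensor_push ?s c) = tensor_push (\<lambda>x. x) c"
        by (rule tensor_push_compose[OF c(2)]) (use surj in \<open>auto simp: f_inv_into_f\<close>)
      also have "\<dots> = c"
        by (rule tensor_push_ident[OF c(2)]) simp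
      finally have "x = tensor_map R N Q g (M.T #>\<^bsub>M.Z\<^esub> tensor_push ?s c)"
        by (simp add: c map_g)
      moreover have "Poly_Mapping.keys (tensor_push ?s c) \<subseteq> carrier N \<times> carrier M"
        by (rule keys_tensor_push[OF c(2)]) (use surj in \<open>auto intro: inv_into_into\<close>)
      ultimately show "x \<in> tensor_map R N Q g ` carrier (tensor_product R N M)"
        unfolding M.carrier_tensor_product by blast
    qed
  qed
  moreover have "tensor_map R N M f ` carrier (tensor_product R N L) =
    kernel (tensor_product R N M) (tensor_product R N Q) (tensor_map R N Q g)"
  proof
    \<comment> \<open>The additivity relator for \<open>\<zero> \<oplus> \<zero>\<close> is the
      negative of the generator at \<open>(n, \<zero>)\<close>, so
      \<open>n \<otimes> \<zero>\<close> vanishes.\<close>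
    have zero: "tensor_push (\<lambda>_. \<zero>\<^bsub>Q\<^esub>) c \<in> Q.T"
      if "Poly_Mapping.keys c \<subseteq> carrier N \<times> carrier L" for c
      using that
    proof (rule free_Abelian_group_induct)
      fix a assume "a \<in> carrier N \<times> carrier L"
      then show "tensor_push (\<lambda>_. \<zero>\<^bsub>Q\<^esub>) (frag_of a) \<in> Q.T"
        using Q.T_minus[OF Q.relator_add_right[of "fst a" "\<zero>\<^bsub>Q\<^esub>" "\<zero>\<^bsub>Q\<^esub>"]] by auto
    qed (simp_all add: Q.T_0 Q.T_diff)
    have "g (f l) = \<zero>\<^bsub>Q\<^esub>" if "l \<in> carrier L" for l
      using that ker by (auto simp: kernel_def)
    then have "tensor_push g (tensor_push f c) \<in> Q.T"
      if "Poly_Mapping.keys c \<subseteq> carrier N \<times> carrier L" for c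
      using tensor_push_compose[OF that, of g f "\<lambda>_. \<zero>\<^bsub>Q\<^esub>"] zero[OF that] by simp
    then have "M.T #>\<^bsub>M.Z\<^esub> tensor_push f c \<in>
        kernel (tensor_product R N M) (tensor_product R N Q) (tensor_map R N Q g)"
      if "Poly_Mapping.keys c \<subseteq> carrier N \<times> carrier L" for c
      unfolding kernel_def M.carrier_tensor_product mem_Collect_eq map_g Q.one_tensor_product
        Q.coset_eq_T_iff
      using that keys_f by blast
    then show "tensor_map R N M f ` carrier (tensor_product R N L) \<subseteq>
        kernel (tensor_product R N M) (tensor_product R N Q) (tensor_map R N Q g)"
      unfolding L.carrier_tensor_product by (auto simp: map_f)
    show "kernel (tensor_product R N M) (tensor_product R N Q) (tensor_map R N Q g) \<subseteq>
        tensor_map R N M f ` carrier (tensor_product R N L)"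
    proof
      fix x assume "x \<in> kernel (tensor_product R N M) (tensor_product R N Q) (tensor_map R N Q g)"
      then obtain c where c: "x = M.T #>\<^bsub>M.Z\<^esub> c" "Poly_Mapping.keys c \<subseteq> carrier N \<times> carrier M"
        "tensor_push g c \<in> Q.T"
        unfolding kernel_def M.carrier_tensor_product
        by (auto simp: map_g Q.one_tensor_product Q.coset_eq_T_iff)
      then obtain d where d: "Poly_Mapping.keys d \<subseteq> carrier N \<times> carrier L" "c - tensor_push f d \<in> M.T"
        using tensor_middle_exact[OF N exact] by blast
      then have "x = tensor_map R N M f (L.T #>\<^bsub>L.Z\<^esub> d)"
        by (simp add: c map_f M.coset_eq_iff)
      then show "x \<in> tensor_map R N M f ` carrier (tensor_product R N L)"
        using d unfolding L.carrier_tensor_product by blast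
    qed
  qed
  ultimately show ?thesis
    unfolding short_exact_def mon_def epi_def
    using L.group_tensor_product M.group_tensor_product Q.group_tensor_product
      tensor_map_hom[OF N modules(1,2) f] tensor_map_hom[OF N modules(2,3) g] by blast
qed

section \<open>Submodules and quotient modules\<close>

lemma is_submodule_simps:
  assumes "is_submodule R L M"
  shows "left_module R M" "submodule (carrier L) R M"
    "ring.add L = ring.add M" "ring.zero L = ring.zero M" "smult L = smult M"
proof -
  have L: "L = M\<lparr>carrier := carrier L\<rparr>"
    using assms by (simp add: is_submodule_def)
  show "left_module R M" "submodule (carrier L) R M"
    using assms by (simp_all add: is_submodule_def)
  show "ring.add L = ring.add M" "ring.zero L = ring.zero M" "smult L = smult M"
    using arg_cong[OF L, of ring.add] arg_cong[OF L, of ring.zero] arg_cong[OF L, of smult] by simp_all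
qed

lemma is_submodule_closed:
  assumes "is_submodule R L M"
  shows "carrier L \<subseteq> carrier M" "\<zero>\<^bsub>M\<^esub> \<in> carrier L"
    "\<And>x y. x \<in> carrier L \<Longrightarrow> y \<in> carrier L \<Longrightarrow> x \<oplus>\<^bsub>M\<^esub> y \<in> carrier L"
    "\<And>x. x \<in> carrier L \<Longrightarrow> \<ominus>\<^bsub>M\<^esub> x \<in> carrier L"
    "\<And>r x. r \<in> carrier R \<Longrightarrow> x \<in> carrier L \<Longrightarrow> r \<odot>\<^bsub>M\<^esub> x \<in> carrier L"
proof -
  interpret submodule "carrier L" R M
    by (rule is_submodule_simps(2)[OF assms])
  show "carrier L \<subseteq> carrier M" "\<zero>\<^bsub>M\<^esub> \<in> carrier L"
    "\<And>x y. x \<in> carrier L \<Longrightarrow> y \<in> carrier L \<Longrightarrow> x \<oplus>\<^bsub>M\<^esub> y \<in> carrier L"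
    "\<And>x. x \<in> carrier L \<Longrightarrow> \<ominus>\<^bsub>M\<^esub> x \<in> carrier L"
    "\<And>r x. r \<in> carrier R \<Longrightarrow> x \<in> carrier L \<Longrightarrow> r \<odot>\<^bsub>M\<^esub> x \<in> carrier L"
    using subset one_closed m_closed m_inv_closed by (simp_all add: a_inv_def)
qed

lemma left_module_submodule:
  assumes "is_submodule R L M"
  shows "left_module R L"
proof -
  interpret M: left_module R M
    by (rule is_submodule_simps(1)[OF assms])
  note L = is_submodule_simps(3-5)[OF assms]
  note closed = is_submodule_closed[OF assms]
  have carrier: "x \<in> carrier M" if "x \<in> carrier L" for x
    using closed(1) that by blast
  have "abelian_group L"
  proof (rule abelian_groupI; unfold L)
    show "\<exists>y\<in>carrier L. y \<oplus>\<^bsub>M\<^esub> x = \<zero>\<^bsub>M\<^esub>" if "x \<in> carrier L" for x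
      using that closed(4) carrier M.l_neg by blast
  qed (simp_all add: closed carrier M.a_ac)
  moreover have "left_module_axioms R L"
    by (rule left_module_axioms.intro; unfold L)
      (simp_all add: closed carrier M.smult_l_distr M.smult_r_distr M.smult_assoc M.smult_one)
  ultimately show ?thesis
    using M.ring_axioms by (intro left_module.intro)
qed

lemma abelian_subgroup_submodule:
  assumes "is_submodule R L M"
  shows "abelian_subgroup (carrier L) M"
proof -
  interpret M: left_module R M
    by (rule is_submodule_simps(1)[OF assms])
  interpret submodule "carrier L" R M
    by (rule is_submodule_simps(2)[OF assms])
  show ?thesis
    by (intro abelian_subgroupI3 additive_subgroupI subgroup_axioms M.abelian_group_axioms)
qed

lemma carrier_quotient_module:
  "carrier (quotient_module M L) = (\<lambda>x. carrier L +>\<^bsub>M\<^esub> x) ` carrier M"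
  unfolding quotient_module_def by (auto simp: A_RCOSETS_def')

lemma zero_quotient_module: "\<zero>\<^bsub>quotient_module M L\<^esub> = carrier L"
  by (simp add: quotient_module_def)

lemma add_quotient_module:
  assumes "is_submodule R L M" "x \<in> carrier M" "y \<in> carrier M"
  shows "(carrier L +>\<^bsub>M\<^esub> x) \<oplus>\<^bsub>quotient_module M L\<^esub> (carrier L +>\<^bsub>M\<^esub> y) =
    carrier L +>\<^bsub>M\<^esub> (x \<oplus>\<^bsub>M\<^esub> y)"
  using abelian_subgroup.a_rcos_sum[OF abelian_subgroup_submodule[OF assms(1)] assms(2,3)]
  by (simp add: quotient_module_def)

text \<open>The union that defines the scalar action has constant terms: replacing \<open>x\<close>
  by \<open>h + x\<close> with \<open>h\<close> in \<open>L\<close> changes the multiple by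
  \<open>r\<close> times \<open>h\<close>, again in \<open>L\<close>.\<close>

lemma smult_quotient_module:
  assumes L: "is_submodule R L M" and r: "r \<in> carrier R" and x: "x \<in> carrier M"
  shows "r \<odot>\<^bsub>quotient_module M L\<^esub> (carrier L +>\<^bsub>M\<^esub> x) = carrier L +>\<^bsub>M\<^esub> (r \<odot>\<^bsub>M\<^esub> x)"
proof -
  interpret M: left_module R M
    by (rule is_submodule_simps(1)[OF L])
  interpret sub: abelian_subgroup "carrier L" M
    by (rule abelian_subgroup_submodule[OF L])
  note closed = is_submodule_closed[OF L]
  have "carrier L +>\<^bsub>M\<^esub> (r \<odot>\<^bsub>M\<^esub> y) = carrier L +>\<^bsub>M\<^esub> (r \<odot>\<^bsub>M\<^esub> x)" if y: "y \<in> carrier L +>\<^bsub>M\<^esub> x" for y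
  proof -
    obtain h where h: "h \<in> carrier L" "y = h \<oplus>\<^bsub>M\<^esub> x"
      using y unfolding a_r_coset_def' by blast
    then have "h \<in> carrier M" "r \<odot>\<^bsub>M\<^esub> h \<in> carrier L" "r \<odot>\<^bsub>M\<^esub> h \<in> carrier M"
      using closed r by auto
    then have "carrier L +>\<^bsub>M\<^esub> (r \<odot>\<^bsub>M\<^esub> y) = (carrier L +>\<^bsub>M\<^esub> (r \<odot>\<^bsub>M\<^esub> h)) +>\<^bsub>M\<^esub> (r \<odot>\<^bsub>M\<^esub> x)"
      using r x closed(1) by (simp add: h M.smult_r_distr M.smult_closed M.a_coset_add_assoc)
    also have "carrier L +>\<^bsub>M\<^esub> (r \<odot>\<^bsub>M\<^esub> h) = carrier L"
      using \<open>r \<odot>\<^bsub>M\<^esub> h \<in> carrier L\<close> \<open>r \<odot>\<^bsub>M\<^esub> h \<in> carrier M\<close>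
      by (intro M.a_coset_join2 sub.a_subgroup)
    finally show ?thesis .
  qed
  then have "(\<Union>y\<in>carrier L +>\<^bsub>M\<^esub> x. carrier L +>\<^bsub>M\<^esub> (r \<odot>\<^bsub>M\<^esub> y)) =
      (\<Union>y\<in>carrier L +>\<^bsub>M\<^esub> x. carrier L +>\<^bsub>M\<^esub> (r \<odot>\<^bsub>M\<^esub> x))"
    by (intro SUP_cong refl)
  also have "\<dots> = carrier L +>\<^bsub>M\<^esub> (r \<odot>\<^bsub>M\<^esub> x)"
    using sub.a_rcos_self[OF x] by blast
  finally show ?thesis
    by (simp add: quotient_module_def)
qed

lemma left_module_quotient:
  assumes L: "is_submodule R L M"
  shows "left_module R (quotient_module M L)"
proof -
  interpret M: left_module R M
    by (rule is_submodule_simps(1)[OF L])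
  interpret sub: abelian_subgroup "carrier L" M
    by (rule abelian_subgroup_submodule[OF L])
  let ?Q = "quotient_module M L" and ?c = "\<lambda>x. carrier L +>\<^bsub>M\<^esub> x"
  note add = add_quotient_module[OF L] and smult = smult_quotient_module[OF L]
  have zero: "\<zero>\<^bsub>?Q\<^esub> = ?c \<zero>\<^bsub>M\<^esub>"
    using M.a_coset_add_zero[OF sub.a_subset] by (simp add: zero_quotient_module)
  have "abelian_group ?Q"
  proof (rule abelian_groupI; unfold carrier_quotient_module zero; (elim imageE)?)
    show "\<exists>Y\<in>?c ` carrier M. Y \<oplus>\<^bsub>?Q\<^esub> X = ?c \<zero>\<^bsub>M\<^esub>" if "X = ?c x" "x \<in> carrier M" for X x
      using that by (intro bexI[of _ "?c (\<ominus>\<^bsub>M\<^esub> x)"]) (simp_all add: add M.l_neg)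
  qed (simp_all add: add M.a_ac)
  moreover have "left_module_axioms R ?Q"
    by (rule left_module_axioms.intro; unfold carrier_quotient_module; elim imageE)
      (simp_all add: add smult M.smult_closed M.smult_l_distr M.smult_r_distr M.smult_assoc M.smult_one)
  ultimately show ?thesis
    using M.ring_axioms by (intro left_module.intro)
qed

lemma short_exact_quotient:
  assumes L: "is_submodule R L M"
  shows "short_exact_modules R L M (quotient_module M L) (\<lambda>x. x) (\<lambda>x. carrier L +>\<^bsub>M\<^esub> x)"
proof -
  interpret M: left_module R M
    by (rule is_submodule_simps(1)[OF L])
  interpret L: left_module R L
    by (rule left_module_submodule[OF L])
  interpret Q: left_module R "quotient_module M L"
    by (rule left_module_quotient[OF L])
  interpret sub: abelian_subgroup "carrier L" M
    by (rule abelian_subgroup_submodule[OF L])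
  note closed = is_submodule_closed[OF L]
  have inclusion: "linear_over R L M (\<lambda>x. x)"
    using closed(1) is_submodule_simps(3,5)[OF L] by (auto simp: linear_over_def hom_def)
  have projection: "linear_over R M (quotient_module M L) (\<lambda>x. carrier L +>\<^bsub>M\<^esub> x)"
    using add_quotient_module[OF L] smult_quotient_module[OF L]
    by (auto simp: linear_over_def hom_def carrier_quotient_module)
  have "carrier L = {x \<in> carrier M. carrier L +>\<^bsub>M\<^esub> x = carrier L}"
    using closed(1) M.a_coset_join2[OF _ sub.a_subgroup] M.a_coset_join1[OF _ _ sub.a_subgroup] by auto
  then have kernel: "(\<lambda>x. x) ` carrier L =
      kernel (add_monoid M) (add_monoid (quotient_module M L)) (\<lambda>x. carrier L +>\<^bsub>M\<^esub> x)"
    by (simp add: kernel_def zero_quotient_module)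
  have "(\<lambda>x. carrier L +>\<^bsub>M\<^esub> x) ` carrier M = carrier (quotient_module M L)"
    by (simp add: carrier_quotient_module)
  with inclusion projection kernel show ?thesis
    by (simp add: short_exact_modules_def short_exact_def mon_def epi_def linear_over_def
        L.a_group M.a_group Q.a_group L.left_module_axioms M.left_module_axioms Q.left_module_axioms)
qed

section \<open>Purity from local retractions\<close>

text \<open>A relator involves at most two elements of \<open>M\<close> besides their sum or a
  multiple, and these lie in every submodule that contains the former. A relation is a finite
  combination of relators, and the finite sets are united along it.\<close>

lemma tensor_subgroup_finite_support:
  assumes "right_module R N" "left_module R M" "c \<in> tensor_subgroup R N M"
  shows "\<exists>F. finite F \<and> F \<subseteq> carrier M \<and>
    (\<forall>W. is_submodule R W M \<longrightarrow> F \<subseteq> carrier W \<longrightarrow> c \<in> tensor_subgroup R N W)"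
    (is "\<exists>F. ?P F c")
proof -
  interpret M: tensor_pair R N M
    by (intro tensor_pair.intro assms)
  have W: "tensor_pair R N W" if "is_submodule R W M" for W
    by (intro tensor_pair.intro assms left_module_submodule[OF that])
  show ?thesis
    using assms(3)
  proof (induction rule: M.T_induct)
    case zero
    show ?case
      by (intro exI[of _ "{}"]) (simp add: tensor_pair.T_0[OF W])
  next
    case (add_left n n' m)
    then show ?case
      by (intro exI[of _ "{m}"]) (simp add: tensor_pair.relator_add_left[OF W])
  next
    case (add_right n m m')
    have "frag_of (n, m \<oplus>\<^bsub>M\<^esub> m') - frag_of (n, m) - frag_of (n, m') \<in> tensor_subgroup R N W"
      if "is_submodule R W M" "{m, m'} \<subseteq> carrier W" for W
      using tensor_pair.relator_add_right[OF W, of W n m m'] that add_right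
        is_submodule_simps(3)[OF that(1)] by simp
    then show ?case
      using add_right by (intro exI[of _ "{m, m'}"]) auto
  next
    case (smult n r m)
    have "frag_of (r \<odot>\<^bsub>N\<^esub> n, m) - frag_of (n, r \<odot>\<^bsub>M\<^esub> m) \<in> tensor_subgroup R N W"
      if "is_submodule R W M" "{m} \<subseteq> carrier W" for W
      using tensor_pair.relator_smult[OF W, of W n r m] that smult
        is_submodule_simps(5)[OF that(1)] by simp
    then show ?case
      using smult by (intro exI[of _ "{m}"]) auto
  next
    case (minus c)
    then obtain F where "?P F c"
      by blast
    then show ?case
      by (intro exI[of _ F]) (simp add: tensor_pair.T_minus[OF W])
  next
    case (add c d)
    then obtain F G where "?P F c" "?P G d"
      by blast
    then show ?case
      by (intro exI[of _ "F \<union> G"]) (simp add: tensor_pair.T_add[OF W])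
  qed
qed

text \<open>Membership in the relations of \<open>N \<otimes> M\<close> involves only finitely many elements of \<open>M\<close>, so
  injectivity of \<open>N \<otimes> L \<rightarrow> N \<otimes> M\<close> needs retractions to \<open>L\<close> only from finitely generated extensions.\<close>

lemma pure_submodule_if_local_retractions:
  fixes T :: "'n itself" and R :: "('r, 'q) ring_scheme" and L M :: "('r, 'm) module"
  assumes L: "is_submodule R L M"
    and retraction: "\<And>F. \<lbrakk>finite F; F \<subseteq> carrier M\<rbrakk> \<Longrightarrow>
      \<exists>W \<phi>. is_submodule R W M \<and> F \<subseteq> carrier W \<and> carrier L \<subseteq> carrier W \<and>
        linear_over R W L \<phi> \<and> (\<forall>x\<in>carrier L. \<phi> x = x)"
  shows "pure_submodule T R L M"
proof -
  note exact = short_exact_quotient[OF L]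
  have "short_exact (tensor_product R N L) (tensor_product R N M)
      (tensor_product R N (quotient_module M L)) (tensor_map R N M (\<lambda>x. x))
      (tensor_map R N (quotient_module M L) (\<lambda>x. carrier L +>\<^bsub>M\<^esub> x))"
    if N: "right_module R N" for N :: "('r, 'n) module"
  proof (rule tensor_short_exact[OF N exact])
    fix c assume keys: "Poly_Mapping.keys c \<subseteq> carrier N \<times> carrier L"
      and "tensor_push (\<lambda>x. x) c \<in> tensor_subgroup R N M"
    then have "c \<in> tensor_subgroup R N M"
      using tensor_push_ident[OF keys, of "\<lambda>x. x"] by simp
    from tensor_subgroup_finite_support[OF N is_submodule_simps(1)[OF L] this]
    obtain F where F: "finite F" "F \<subseteq> carrier M"
      "\<forall>W. is_submodule R W M \<longrightarrow> F \<subseteq> carrier W \<longrightarrow> c \<in> tensor_subgroup R N W"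
      by (elim exE conjE) (rule that)
    obtain W \<phi> where W: "is_submodule R W M" "F \<subseteq> carrier W"
      and \<phi>: "linear_over R W L \<phi>" "\<forall>x\<in>carrier L. \<phi> x = x"
      using retraction[OF F(1,2)] by (elim exE conjE) (rule that)
    \<comment> \<open>\<open>c\<close> is already a relation over \<open>W\<close>. Pushing it along
      \<open>\<phi>\<close> gives a relation over \<open>L\<close> and does not change it, since its
      module entries lie in \<open>L\<close>.\<close>
    have "tensor_push \<phi> c \<in> tensor_subgroup R N L"
      using tensor_push_subgroup[OF N left_module_submodule[OF W(1)] left_module_submodule[OF L] \<phi>(1)]
        F(3)[rule_format, OF W] by blast
    then show "c \<in> tensor_subgroup R N L"
      using tensor_push_ident[OF keys, of \<phi>] \<phi>(2) by simp
  qed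
  then show ?thesis
    using L exact by (simp add: pure_submodule_def pure_exact_def)
qed


section \<open>Linear relations as Kronecker modules\<close>

text \<open>These are the index sets of the sum that defines multiplication: an arrow factors only
  trivially, through the vertex at its source or at its target.\<close>

lemma path_comp_eq_Some:
  "{(b, a). path_comp b a = Some Vertex_X} = {(Vertex_X, Vertex_X)}"
  "{(b, a). path_comp b a = Some Vertex_Y} = {(Vertex_Y, Vertex_Y)}"
  "{(b, a). path_comp b a = Some Arrow_p} = {(Arrow_p, Vertex_X), (Vertex_Y, Arrow_p)}"
  "{(b, a). path_comp b a = Some Arrow_q} = {(Arrow_q, Vertex_X), (Vertex_Y, Arrow_q)}"
proof -
  have "path_comp b a = Some c \<longleftrightarrow> (b, a) \<in> S"
    if "(c, S) \<in> {(Vertex_X, {(Vertex_X, Vertex_X)}), (Vertex_Y, {(Vertex_Y, Vertex_Y)}),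
      (Arrow_p, {(Arrow_p, Vertex_X), (Vertex_Y, Arrow_p)}),
      (Arrow_q, {(Arrow_q, Vertex_X), (Vertex_Y, Arrow_q)})}" for a b c S
    using that by (cases a; cases b) (auto simp: path_comp_def)
  then show
    "{(b, a). path_comp b a = Some Vertex_X} = {(Vertex_X, Vertex_X)}"
    "{(b, a). path_comp b a = Some Vertex_Y} = {(Vertex_Y, Vertex_Y)}"
    "{(b, a). path_comp b a = Some Arrow_p} = {(Arrow_p, Vertex_X), (Vertex_Y, Arrow_p)}"
    "{(b, a). path_comp b a = Some Arrow_q} = {(Arrow_q, Vertex_X), (Vertex_Y, Arrow_q)}"
    by auto
qed

lemma kronecker_algebra_simps:
  "carrier kronecker_algebra = UNIV"
  "\<zero>\<^bsub>kronecker_algebra\<^esub> = (\<lambda>c. 0)"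
  "f \<oplus>\<^bsub>kronecker_algebra\<^esub> g = (\<lambda>c. f c + g c)"
  "\<one>\<^bsub>kronecker_algebra\<^esub> = (\<lambda>c. if c = Vertex_X \<or> c = Vertex_Y then 1 else 0)"
  by (simp_all add: kronecker_algebra_def)

lemma kronecker_algebra_mult:
  "(f \<otimes>\<^bsub>kronecker_algebra\<^esub> g) Vertex_X = f Vertex_X * g Vertex_X"
  "(f \<otimes>\<^bsub>kronecker_algebra\<^esub> g) Vertex_Y = f Vertex_Y * g Vertex_Y"
  "(f \<otimes>\<^bsub>kronecker_algebra\<^esub> g) Arrow_p = f Arrow_p * g Vertex_X + f Vertex_Y * g Arrow_p"
  "(f \<otimes>\<^bsub>kronecker_algebra\<^esub> g) Arrow_q = f Arrow_q * g Vertex_X + f Vertex_Y * g Arrow_q"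
  by (simp_all add: kronecker_algebra_def path_comp_eq_Some)

lemma kronecker_element_eqI:
  "\<lbrakk>f Vertex_X = g Vertex_X; f Vertex_Y = g Vertex_Y; f Arrow_p = g Arrow_p; f Arrow_q = g Arrow_q\<rbrakk>
    \<Longrightarrow> f = g"
  by (rule ext) (metis kronecker_path.exhaust)

lemma ring_kronecker_algebra: "ring (kronecker_algebra :: (kronecker_path \<Rightarrow> 'k::field) ring)"
proof (rule ringI)
  let ?A = "kronecker_algebra :: (kronecker_path \<Rightarrow> 'k) ring"
  show "abelian_group ?A"
  proof (rule abelian_groupI)
    show "\<exists>g\<in>carrier ?A. g \<oplus>\<^bsub>?A\<^esub> f = \<zero>\<^bsub>?A\<^esub>" for f
      by (intro bexI[of _ "\<lambda>c. - f c"]) (simp_all add: kronecker_algebra_simps)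
  qed (simp_all add: kronecker_algebra_simps ac_simps)
  show "monoid ?A"
    by (rule monoidI; (rule kronecker_element_eqI)?)
      (simp_all add: kronecker_algebra_simps kronecker_algebra_mult algebra_simps)
qed (rule kronecker_element_eqI;
    simp add: kronecker_algebra_simps kronecker_algebra_mult algebra_simps)+

section \<open>Kronecker modules attached to linear relations\<close>

context ambient_space
begin

lemma relation_module_simps:
  "carrier (relation_module scale V C) = C \<times> V"
  "\<zero>\<^bsub>relation_module scale V C\<^esub> = 0"
  "u \<oplus>\<^bsub>relation_module scale V C\<^esub> v = u + v"
  by (simp_all add: relation_module_def kronecker_module_def)

lemma relation_module_smult:
  "f \<odot>\<^bsub>relation_module scale V C\<^esub> ((a, b), y) =
    ((f Vertex_X *s a, f Vertex_X *s b), f Vertex_Y *s y + f Arrow_p *s a + f Arrow_q *s b)"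
proof -
  interpret P: vector_space_prod scale scale
    by unfold_locales
  show ?thesis
    by (simp add: relation_module_def kronecker_module_def P.scale_prod)
qed

lemma left_module_relation_module:
  assumes V: "subspace V" and C: "pair_subspace C" "C \<subseteq> V \<times> V"
  shows "left_module kronecker_algebra (relation_module scale V C)"
proof -
  let ?M = "relation_module scale V C"
  have C_V: "a \<in> V" "b \<in> V" if "(a, b) \<in> C" for a b
    using C(2) that by auto
  have "abelian_group ?M"
  proof (rule abelian_groupI)
    show "\<exists>v\<in>carrier ?M. v \<oplus>\<^bsub>?M\<^esub> u = \<zero>\<^bsub>?M\<^esub>" if "u \<in> carrier ?M" for u
    proof
      obtain a b y where "u = ((a, b), y)" "(a, b) \<in> C" "y \<in> V"
        using \<open>u \<in> carrier ?M\<close> by (auto simp: relation_module_simps)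
      then show "- u \<in> carrier ?M"
        using pair_subspace_scale[OF C(1), of a b "-1"] subspace_neg[OF V]
        by (simp add: relation_module_simps)
    qed (simp add: relation_module_simps)
  qed (auto simp: relation_module_simps zero_prod_def ac_simps subspace_0[OF V] pair_subspace_0[OF C(1)]
      subspace_add[OF V] pair_subspace_add[OF C(1)])
  moreover have "left_module_axioms kronecker_algebra ?M"
    by (rule left_module_axioms.intro)
      (auto simp: relation_module_simps relation_module_smult kronecker_algebra_simps
        kronecker_algebra_mult algebra_simps C_V
        intro!: subspace_add[OF V] subspace_scale[OF V] pair_subspace_scale[OF C(1)])
  ultimately show ?thesis
    by (intro left_module.intro ring_kronecker_algebra)
qed

lemma relation_submodule:
  assumes V: "subspace V" and C: "pair_subspace C" "C \<subseteq> V \<times> V" and U: "subspace U" "U \<subseteq> V"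
  shows "is_submodule kronecker_algebra (relation_module scale U (relation_restrict C U))
    (relation_module scale V C)"
proof -
  let ?M = "relation_module scale V C" and ?D = "relation_restrict C U"
  interpret M: left_module kronecker_algebra ?M
    by (rule left_module_relation_module[OF V C])
  have D: "pair_subspace ?D"
    using C(1) U(1) unfolding relation_restrict_def pair_subspace_iff subspace_def by auto
  interpret L: left_module kronecker_algebra "relation_module scale U ?D"
    by (rule left_module_relation_module[OF U(1) D]) (auto simp: relation_restrict_def)
  have ops: "ring.add (relation_module scale U ?D) = ring.add ?M"
    "ring.zero (relation_module scale U ?D) = ring.zero ?M"
    "smult (relation_module scale U ?D) = smult ?M"
    by (simp_all add: relation_module_def kronecker_module_def)
  have subset: "?D \<times> U \<subseteq> C \<times> V"
    using U(2) by (auto simp: relation_restrict_def)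
  have "submodule (?D \<times> U) kronecker_algebra ?M"
  proof (rule submodule.intro)
    show "subgroup (?D \<times> U) (add_monoid ?M)"
    proof (rule subgroup.intro)
      show "inv\<^bsub>add_monoid ?M\<^esub> u \<in> ?D \<times> U" if u: "u \<in> ?D \<times> U" for u
      proof -
        \<comment> \<open>The additive inverse within the smaller module is also one in
          \<open>?M\<close>, and inverses there are unique.\<close>
        obtain v where v: "v \<in> ?D \<times> U" "v \<oplus>\<^bsub>?M\<^esub> u = \<zero>\<^bsub>?M\<^esub>"
          using L.l_neg[of u] L.a_inv_closed[of u] u
          by (simp add: ops relation_module_simps(1))
        then have "\<ominus>\<^bsub>?M\<^esub> u = v"
          using u subset by (intro M.minus_equality) (auto simp: relation_module_simps(1))
        then show ?thesis
          using v(1) by (simp add: a_inv_def)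
      qed
    qed (use subset L.zero_closed L.a_closed in \<open>simp_all add: ops relation_module_simps(1)\<close>)
    show "submodule_axioms (?D \<times> U) kronecker_algebra ?M"
      using L.smult_closed by (simp add: submodule_axioms_def ops relation_module_simps(1))
  qed
  then show ?thesis
    unfolding is_submodule_def using M.left_module_axioms
    by (simp add: relation_module_def kronecker_module_def)
qed

text \<open>A retraction that respects \<open>C\<close> acts on pairs and on vectors and commutes
  with both projections, so it is a map of Kronecker modules. This reduces purity to linear algebra
  inside \<open>V\<close>.\<close>

lemma pure_relation_submodule:
  assumes V: "subspace V" and C: "pair_subspace C" "C \<subseteq> V \<times> V" and U: "subspace U" "U \<subseteq> V"
    and retraction: "\<And>F. \<lbrakk>finite F; F \<subseteq> V\<rbrakk> \<Longrightarrow> \<exists>\<phi>. relation_retraction C U (span (U \<union> F)) \<phi>"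
  shows "pure_submodule T kronecker_algebra (relation_module scale U (relation_restrict C U))
    (relation_module scale V C)"
proof (rule pure_submodule_if_local_retractions[OF relation_submodule[OF V C U]])
  fix G assume G: "finite G" "G \<subseteq> carrier (relation_module scale V C)"
  \<comment> \<open>All coordinates of the elements of \<open>G\<close>, so that \<open>G\<close>
    lies in the Kronecker module of \<open>span (U \<union> F)\<close>.\<close>
  define F where "F = snd ` G \<union> fst ` fst ` G \<union> snd ` fst ` G"
  have "finite F"
    using G(1) by (simp add: F_def)
  moreover have "F \<subseteq> V"
    using G(2) C(2) by (fastforce simp: F_def relation_module_simps)
  ultimately obtain \<phi> where \<phi>: "relation_retraction C U (span (U \<union> F)) \<phi>"
    using retraction by blast
  let ?W = "span (U \<union> F)"
  let ?\<Phi> = "\<lambda>((a, b), y). ((\<phi> a, \<phi> b), \<phi> y)"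
  have W: "subspace ?W" "?W \<subseteq> V"
    using U(2) V \<open>F \<subseteq> V\<close> by (auto simp: span_minimal)
  have U_W: "U \<subseteq> ?W"
    using span_superset by blast
  have \<phi>_rules: "lin \<phi>" "\<And>x. x \<in> ?W \<Longrightarrow> \<phi> x \<in> U" "\<And>x. x \<in> U \<Longrightarrow> \<phi> x = x"
    "\<And>x y. x \<in> ?W \<Longrightarrow> y \<in> ?W \<Longrightarrow> (x, y) \<in> C \<Longrightarrow> (\<phi> x, \<phi> y) \<in> C"
    using \<phi> by (auto simp: relation_retraction_def)
  have "G \<subseteq> relation_restrict C ?W \<times> ?W"
  proof
    fix u assume u: "u \<in> G"
    obtain a b y where aby: "u = ((a, b), y)"
      by (metis surj_pair)
    then have "a \<in> F" "b \<in> F" "y \<in> F"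
      using u by (force simp: F_def)+
    moreover have "(a, b) \<in> C"
      using u G(2) by (auto simp: aby relation_module_simps(1))
    ultimately show "u \<in> relation_restrict C ?W \<times> ?W"
      by (simp add: aby relation_restrict_def span_base)
  qed
  moreover have "linear_over kronecker_algebra (relation_module scale ?W (relation_restrict C ?W))
      (relation_module scale U (relation_restrict C U)) ?\<Phi>"
    unfolding linear_over_def hom_def
    by (auto simp: relation_module_simps relation_module_smult relation_restrict_def \<phi>_rules(2-4)
        lin_add[OF \<phi>_rules(1)] lin_scale[OF \<phi>_rules(1)])
  moreover have "\<forall>x\<in>relation_restrict C U \<times> U. ?\<Phi> x = x"
    by (auto simp: relation_restrict_def \<phi>_rules(3))
  moreover have "relation_restrict C U \<times> U \<subseteq> relation_restrict C ?W \<times> ?W"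
    using U_W by (auto simp: relation_restrict_def)
  ultimately show "\<exists>W \<Phi>. is_submodule kronecker_algebra W (relation_module scale V C) \<and>
      G \<subseteq> carrier W \<and> carrier (relation_module scale U (relation_restrict C U)) \<subseteq> carrier W \<and>
      linear_over kronecker_algebra W (relation_module scale U (relation_restrict C U)) \<Phi> \<and>
      (\<forall>x\<in>carrier (relation_module scale U (relation_restrict C U)). \<Phi> x = x)"
    using relation_submodule[OF V C W]
    by (intro exI[of _ "relation_module scale ?W (relation_restrict C ?W)"] exI[of _ ?\<Phi>] conjI)
      (simp_all add: relation_module_simps(1))
qed

end

theorem theorem1p2:
  fixes scaleV :: "'k::field \<Rightarrow> 'v::ab_group_add \<Rightarrow> 'v"
    and V :: "'v set" and C :: "('v \<times> 'v) set"
  assumes "linear_relation scaleV V C"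
  shows "pure_submodule TYPE('n) kronecker_algebra
           (relation_module scaleV (rel_flat V C) (relation_restrict C (rel_flat V C)))
           (relation_module scaleV V C) \<and>
         pure_submodule TYPE('n) kronecker_algebra
           (relation_module scaleV (rel_sharp V C) (relation_restrict C (rel_sharp V C)))
           (relation_module scaleV V C)"
proof -
  interpret vector_space scaleV
    using assms by (simp add: linear_relation_def)
  interpret ambient_space scaleV
    by unfold_locales
  have V: "subspace V" and C: "pair_subspace C" "C \<subseteq> V \<times> V"
    using assms by (auto simp: linear_relation_def)
  show ?thesis
    by (intro conjI pure_relation_submodule V C subspace_rel_flat subspace_rel_sharp rel_flat_subset
        rel_sharp_subset rel_flat_retraction rel_sharp_retraction)
qed

end
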